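(* Let $T\in(0,\infty)$, $a>0$, and consider the controlled system, for $s\in[0,T]$, $$\left\{\begin{aligned}& \dot{\mathbf{u}}_{\varepsilon}(s) = -D\mathbf{v}_{\varepsilon}(s) -D\mathbf{w}_{\varepsilon}(s) + \mathbb{H}(\mathbf{u}_{\varepsilon}(s))\alpha(s), && \mathbf{u}_{\varepsilon}(0) = \mathbf{u}_0\in\mathbb{R}^m, \\ & \dot{\mathbf{v}}_{\varepsilon}(s) = -a\, D \mathbf{u}_{\varepsilon}(s) , && \mathbf{v}_{\varepsilon}(0)=\mathbf{v}_0\in\mathbb{R}^m, \\ & \dot{\mathbf{w}}_{\varepsilon}(s) = -\tfrac{1}{\varepsilon}\big[ \mathbf{v}_{\varepsilon}(s)-\mathcal{F}(\mathbf{u}_{\varepsilon}(s)) - \mathbb{G}(\mathbf{u}_{\varepsilon}(s))\beta(s) +\mathbf{w}_{\varepsilon}(s)\big], && \mathbf{w}_{\varepsilon}(0) = \mathbf{w}_0\in\mathbb{R}^m,\end{aligned}\right.\tag{E}$$ and the reduced system $$\dot{\mathbf{u}}(s) + D\big[\mathcal{F}(\mathbf{u}(s))+\mathbb{G}(\mathbf{u}(s))\beta(s)\big] = \mathbb{H}(\mathbf{u}(s))\alpha(s),\quad s\in (0,T],\qquad \mathbf{u}(0) = \mathbf{u}_{0}.\tag{E$_0$}$$ Let $\Phi$ be a continuous cost. As $\varepsilon\to 0$, the problem $$\inf\ \Phi(\mathbf{u}_{\varepsilon}(T))\quad\text{subject to (E)}$$ is approximated (in the sense defined in the context) by the problem $$\inf\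 \Phi(\mathbf{u}(T))\quad\text{subject to (E}_0).$$ In particular, the controlled system (E) with any given initial conditions converges to (E$_0$) locally uniformly on any finite time interval, and $\inf \Phi(\mathbf{u}_{\varepsilon}(T)) \to \inf \Phi(\mathbf{u}(T))$.
   Context: Here $D$ is a fixed $m\times m$ matrix (a spatial discretisation of the transport operator $\partial_x$; its specific structure is not relevant). The controls $\alpha(\cdot),\beta(\cdot)$ are measurable with values in compact convex sets $\Omega_A\subset\mathbb{R}^p$, $\Omega_B\subset\mathbb{R}^q$. $\mathcal{F}:\mathbb{R}^m\to\mathbb{R}^m$ is a vector-valued function; $\mathbb{H}:\mathbb{R}^m\to\mathbb{M}^{m,p}$ and $\mathbb{G}:\mathbb{R}^m\to\mathbb{M}^{m,q}$ are matrix-valued functions; all are locally Lipschitz with at most linear growth. $\Phi:\mathbb{R}^m\to\mathbb{R}$ is continuous. Infima are over all admissible controls; an admissible trajectory is one generated by admissible controls. Definition (approximating control). Given a trajectory $x(\cdot)$, an admissible control $(\alpha_{x(\cdot)},\beta_{x(\cdot)})$ is called $x(\cdot)$-approximating if it generates in the singularly perturbed system a slow trajectory $z_\varepsilon(\cdot)$ with $\max_s\|z_\varepsilon(s)-x(s)\|\le\mu(\varepsilon)\to0$ as $\varepsilon\to0$. (This control need not be the control of the trajectory $x(\cdot)$.) Here the slow variables are $\mathbf u_\varepsilon,\mathbf v_\varepsilon$, and along the reduced dynamics (E$_0$) the variable $\mathbf v$ solves $\dot{\mathbf v}=-aD\mathbf u$, $\mathbf v(0)=\mathbf v_0$; since only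 $\mathbf u$ enters the cost, $\mathbf v$ is omitted from the reduced problem. Definition (approximated by). Let $G_\varepsilon$ be the infimum of the singularly perturbed problem (terminal cost $\Phi$) and $\bar G$ the infimum of the reduced problem. The singularly perturbed problem is approximated by the reduced problem if $G_\varepsilon\to\bar G$ as $\varepsilon\to0$ and if, for every $\nu>0$ and every admissible trajectory $\bar z_\nu(\cdot)$ of the reduced system whose terminal cost is $\le\bar G+\nu$, there exists a $\bar z_\nu(\cdot)$-approximating control giving in the singularly perturbed problem a value of the functional that differs from the optimal one by at most $\nu+\kappa(\varepsilon)$, where $\kappa(\varepsilon)\to0$ as $\varepsilon\to0$. *)

theory Defs
  imports "HOL-Analysis.Analysis"
begin

text \<open>
  Absolute continuity of a curve on a compact interval, in the usual epsilon-delta sense;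
  not to be confused with the library constant \<^term>\<open>absolutely_continuous\<close>,
  which relates two measures.
\<close>

definition abs_cont_on :: "real \<Rightarrow> real \<Rightarrow> (real \<Rightarrow> 'a::real_normed_vector) \<Rightarrow> bool" where
  "abs_cont_on a b f \<longleftrightarrow>
     (\<forall>e>0. \<exists>d>0. \<forall>(n::nat) l r.
        (\<forall>i<n. a \<le> l i \<and> l i \<le> r i \<and> r i \<le> b) \<and>
        disjoint_family_on (\<lambda>i. {l i<..<r i}) {..<n} \<and>
        (\<Sum>i<n. r i - l i) < d \<longrightarrow>
        (\<Sum>i<n. norm (f (r i) - f (l i))) < e)"

text \<open>
  Controls are merely measurable, so differential equations are understood in the sense of
  Caratheodory: an absolutely continuous curve satisfying the equation almost everywhere.
  Here \<open>g s\<close> is the right-hand side already evaluated along the curve.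
\<close>

definition caratheodory ::
    "real \<Rightarrow> (real \<Rightarrow> 'a::real_normed_vector) \<Rightarrow> 'a \<Rightarrow> (real \<Rightarrow> 'a) \<Rightarrow> bool" where
  "caratheodory T g x0 x \<longleftrightarrow>
     abs_cont_on 0 T x \<and> x 0 = x0 \<and>
     (AE s in lebesgue_on {0..T}. (x has_vector_derivative g s) (at s within {0..T}))"

definition admissible :: "real \<Rightarrow> (real^'k) set \<Rightarrow> (real \<Rightarrow> real^'k) \<Rightarrow> bool" where
  "admissible T \<Omega> c \<longleftrightarrow>
     c \<in> borel_measurable (lebesgue_on {0..T}) \<and> (\<forall>s\<in>{0..T}. c s \<in> \<Omega>)"

definition loc_lipschitz :: "('a::metric_space \<Rightarrow> 'b::metric_space) \<Rightarrow> bool" where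
  "loc_lipschitz f \<longleftrightarrow> local_lipschitz (UNIV::real set) UNIV (\<lambda>_. f)"

definition linear_growth :: "('a::real_normed_vector \<Rightarrow> 'b::real_normed_vector) \<Rightarrow> bool" where
  "linear_growth f \<longleftrightarrow> (\<exists>C. \<forall>x. norm (f x) \<le> C * (1 + norm x))"

text \<open>
  The singularly perturbed system; \<open>(u, v)\<close> are the slow variables and \<open>w\<close> the fast one.
\<close>

definition sp_sol ::
    "real \<Rightarrow> real \<Rightarrow> real^'m^'m \<Rightarrow> (real^'m \<Rightarrow> real^'m) \<Rightarrow> (real^'m \<Rightarrow> real^'p^'m) \<Rightarrow>
     (real^'m \<Rightarrow> real^'q^'m) \<Rightarrow> real^'m \<Rightarrow> real^'m \<Rightarrow> real^'m \<Rightarrow> real \<Rightarrow>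
     (real \<Rightarrow> real^'p) \<Rightarrow> (real \<Rightarrow> real^'q) \<Rightarrow>
     (real \<Rightarrow> real^'m) \<Rightarrow> (real \<Rightarrow> real^'m) \<Rightarrow> (real \<Rightarrow> real^'m) \<Rightarrow> bool" where
  "sp_sol T a D F H G u0 v0 w0 \<epsilon> \<alpha> \<beta> u v w \<longleftrightarrow>
     caratheodory T (\<lambda>s. - (D *v v s) - D *v w s + H (u s) *v \<alpha> s) u0 u \<and>
     caratheodory T (\<lambda>s. - (a *\<^sub>R (D *v u s))) v0 v \<and>
     caratheodory T
       (\<lambda>s. - ((1 / \<epsilon>) *\<^sub>R (v s - F (u s) - G (u s) *v \<beta> s + w s))) w0 w"

definition red_sol ::
    "real \<Rightarrow> real^'m^'m \<Rightarrow> (real^'m \<Rightarrow> real^'m) \<Rightarrow> (real^'m \<Rightarrow> real^'p^'m) \<Rightarrow>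
     (real^'m \<Rightarrow> real^'q^'m) \<Rightarrow> real^'m \<Rightarrow>
     (real \<Rightarrow> real^'p) \<Rightarrow> (real \<Rightarrow> real^'q) \<Rightarrow> (real \<Rightarrow> real^'m) \<Rightarrow> bool" where
  "red_sol T D F H G u0 \<alpha> \<beta> u \<longleftrightarrow>
     caratheodory T (\<lambda>s. H (u s) *v \<alpha> s - D *v (F (u s) + G (u s) *v \<beta> s)) u0 u"

text \<open>
  Admissible trajectories of the reduced system in both slow variables. The component \<open>v\<close> is
  slaved to \<open>u\<close> and does not enter the cost, but it is part of the slow trajectory that an
  approximating control has to follow.
\<close>

definition red_traj ::
    "real \<Rightarrow> real \<Rightarrow> real^'m^'m \<Rightarrow> (real^'m \<Rightarrow> real^'m) \<Rightarrow> (real^'m \<Rightarrow> real^'p^'m) \<Rightarrow>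
     (real^'m \<Rightarrow> real^'q^'m) \<Rightarrow> real^'m \<Rightarrow> real^'m \<Rightarrow>
     (real^'p) set \<Rightarrow> (real^'q) set \<Rightarrow> (real \<Rightarrow> real^'m) \<Rightarrow> (real \<Rightarrow> real^'m) \<Rightarrow> bool" where
  "red_traj T a D F H G u0 v0 \<Omega>A \<Omega>B u v \<longleftrightarrow>
     (\<exists>\<alpha> \<beta>. admissible T \<Omega>A \<alpha> \<and> admissible T \<Omega>B \<beta> \<and> red_sol T D F H G u0 \<alpha> \<beta> u) \<and>
     caratheodory T (\<lambda>s. - (a *\<^sub>R (D *v u s))) v0 v"

text \<open>
  The two optimal values are infima in \<open>real\<close>. For locally Lipschitz data of linear growth and
  nonempty compact control sets, every pair of admissible controls generates a trajectory, and all
  trajectories stay in a common bounded set, so these are infima of nonempty bounded sets.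
\<close>

definition sp_value ::
    "real \<Rightarrow> real \<Rightarrow> real^'m^'m \<Rightarrow> (real^'m \<Rightarrow> real^'m) \<Rightarrow> (real^'m \<Rightarrow> real^'p^'m) \<Rightarrow>
     (real^'m \<Rightarrow> real^'q^'m) \<Rightarrow> real^'m \<Rightarrow> real^'m \<Rightarrow> real^'m \<Rightarrow>
     (real^'p) set \<Rightarrow> (real^'q) set \<Rightarrow> (real^'m \<Rightarrow> real) \<Rightarrow> real \<Rightarrow> real" where
  "sp_value T a D F H G u0 v0 w0 \<Omega>A \<Omega>B \<Phi> \<epsilon> =
     Inf {\<Phi> (u T) | u v w \<alpha> \<beta>. admissible T \<Omega>A \<alpha> \<and> admissible T \<Omega>B \<beta> \<and>
            sp_sol T a D F H G u0 v0 w0 \<epsilon> \<alpha> \<beta> u v w}"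

definition red_value ::
    "real \<Rightarrow> real^'m^'m \<Rightarrow> (real^'m \<Rightarrow> real^'m) \<Rightarrow> (real^'m \<Rightarrow> real^'p^'m) \<Rightarrow>
     (real^'m \<Rightarrow> real^'q^'m) \<Rightarrow> real^'m \<Rightarrow>
     (real^'p) set \<Rightarrow> (real^'q) set \<Rightarrow> (real^'m \<Rightarrow> real) \<Rightarrow> real" where
  "red_value T D F H G u0 \<Omega>A \<Omega>B \<Phi> =
     Inf {\<Phi> (u T) | u \<alpha> \<beta>. admissible T \<Omega>A \<alpha> \<and> admissible T \<Omega>B \<beta> \<and>
            red_sol T D F H G u0 \<alpha> \<beta> u}"

text \<open>
  The control pair does not depend on \<open>\<epsilon>\<close>. It need not be one generating the trajectory
  \<open>(ub, vb)\<close>.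
\<close>

definition approximating_control ::
    "real \<Rightarrow> real \<Rightarrow> real^'m^'m \<Rightarrow> (real^'m \<Rightarrow> real^'m) \<Rightarrow> (real^'m \<Rightarrow> real^'p^'m) \<Rightarrow>
     (real^'m \<Rightarrow> real^'q^'m) \<Rightarrow> real^'m \<Rightarrow> real^'m \<Rightarrow> real^'m \<Rightarrow>
     (real^'p) set \<Rightarrow> (real^'q) set \<Rightarrow> (real \<Rightarrow> real^'m) \<Rightarrow> (real \<Rightarrow> real^'m) \<Rightarrow>
     (real \<Rightarrow> real^'p) \<Rightarrow> (real \<Rightarrow> real^'q) \<Rightarrow> bool" where
  "approximating_control T a D F H G u0 v0 w0 \<Omega>A \<Omega>B ub vb \<alpha> \<beta> \<longleftrightarrow>
     admissible T \<Omega>A \<alpha> \<and> admissible T \<Omega>B \<beta> \<and>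
     (\<exists>\<mu>. (\<mu> \<longlongrightarrow> 0) (at_right 0) \<and>
        (\<forall>\<epsilon>>0. \<exists>u v w. sp_sol T a D F H G u0 v0 w0 \<epsilon> \<alpha> \<beta> u v w \<and>
           (\<forall>s\<in>{0..T}. norm ((u s, v s) - (ub s, vb s)) \<le> \<mu> \<epsilon>)))"

definition approximated_by_reduced ::
    "real \<Rightarrow> real \<Rightarrow> real^'m^'m \<Rightarrow> (real^'m \<Rightarrow> real^'m) \<Rightarrow> (real^'m \<Rightarrow> real^'p^'m) \<Rightarrow>
     (real^'m \<Rightarrow> real^'q^'m) \<Rightarrow> real^'m \<Rightarrow> real^'m \<Rightarrow> real^'m \<Rightarrow>
     (real^'p) set \<Rightarrow> (real^'q) set \<Rightarrow> (real^'m \<Rightarrow> real) \<Rightarrow> bool" where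
  "approximated_by_reduced T a D F H G u0 v0 w0 \<Omega>A \<Omega>B \<Phi> \<longleftrightarrow>
     (sp_value T a D F H G u0 v0 w0 \<Omega>A \<Omega>B \<Phi> \<longlongrightarrow> red_value T D F H G u0 \<Omega>A \<Omega>B \<Phi>) (at_right 0) \<and>
     (\<forall>\<nu>>0. \<forall>ub vb.
        red_traj T a D F H G u0 v0 \<Omega>A \<Omega>B ub vb \<and>
        \<Phi> (ub T) \<le> red_value T D F H G u0 \<Omega>A \<Omega>B \<Phi> + \<nu> \<longrightarrow>
        (\<exists>\<alpha> \<beta>. approximating_control T a D F H G u0 v0 w0 \<Omega>A \<Omega>B ub vb \<alpha> \<beta> \<and>
           (\<exists>\<kappa>. (\<kappa> \<longlongrightarrow> 0) (at_right 0) \<and>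
              (\<forall>\<epsilon>>0. \<forall>u v w. sp_sol T a D F H G u0 v0 w0 \<epsilon> \<alpha> \<beta> u v w \<longrightarrow>
                 \<bar>\<Phi> (u T) - sp_value T a D F H G u0 v0 w0 \<Omega>A \<Omega>B \<Phi> \<epsilon>\<bar> \<le> \<nu> + \<kappa> \<epsilon>))))"

text \<open>
  Convergence of the controlled systems: trajectories driven by the same controls converge
  uniformly in time, with a rate that is moreover common to all admissible controls.
\<close>

definition converges_to_reduced ::
    "real \<Rightarrow> real \<Rightarrow> real^'m^'m \<Rightarrow> (real^'m \<Rightarrow> real^'m) \<Rightarrow> (real^'m \<Rightarrow> real^'p^'m) \<Rightarrow>
     (real^'m \<Rightarrow> real^'q^'m) \<Rightarrow> real^'m \<Rightarrow> real^'m \<Rightarrow> real^'m \<Rightarrow>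
     (real^'p) set \<Rightarrow> (real^'q) set \<Rightarrow> bool" where
  "converges_to_reduced T a D F H G u0 v0 w0 \<Omega>A \<Omega>B \<longleftrightarrow>
     (\<exists>\<mu>. (\<mu> \<longlongrightarrow> 0) (at_right 0) \<and>
        (\<forall>\<alpha> \<beta>. admissible T \<Omega>A \<alpha> \<and> admissible T \<Omega>B \<beta> \<longrightarrow>
           (\<forall>\<epsilon>>0. \<forall>ue ve we u.
              sp_sol T a D F H G u0 v0 w0 \<epsilon> \<alpha> \<beta> ue ve we \<and> red_sol T D F H G u0 \<alpha> \<beta> u \<longrightarrow>
              (\<forall>s\<in>{0..T}. norm (ue s - u s) \<le> \<mu> \<epsilon>))))"

end

theory Submission
  imports Defs
begin

text \<open>
  The fast equation gives \<open>D (v + w) = D (F u + G u \<beta>) - \<epsilon> D w'\<close>, so the corrected variable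
  \<open>u - \<epsilon> D w\<close> follows the reduced dynamics driven by the same controls, up to evaluating
  the right-hand side at \<open>u\<close>. The energy \<open>|u|\<^sup>2 + |v|\<^sup>2 + \<epsilon> |w|\<^sup>2\<close> obeys a Gronwall inequality
  with constants independent of \<open>\<epsilon>\<close> and of the controls, hence \<open>\<epsilon> w = O(sqrt \<epsilon>)\<close>, and a second
  Gronwall argument gives convergence of \<open>u\<close> at this rate, uniformly over all controls. Every
  reduced trajectory is therefore approximated by its own control, and the infima converge because
  trajectories of the two problems are paired control by control.

  Caratheodory solutions exist by Picard's contraction in a weighted supremum norm. That the
  resulting integral curve satisfies the equation almost everywhere is the Lebesgue
  differentiation theorem on the line, which follows from Henstock's lemma and Vitali's covering theorem.
\<close>

subsection \<open>Absolutely continuous functions and their derivatives\<close>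

text \<open>Since \<open>\<beta>\<close> is merely measurable, the rest point
  \<open>F u + G u \<beta>\<close> of \<open>v + w\<close> may jump at every scale, so
  \<open>w\<close> cannot be expected to follow it pointwise, and an estimate of the distance to a
  slow manifold is out of reach. What has to converge is only the integrated effect of
  \<open>w\<close> on \<open>u\<close>, and there the fast equation is exact: the discrepancy is the
  derivative of \<open>\<epsilon> D w\<close>, so smallness of \<open>\<epsilon> w\<close> suffices.
  For the same reason an arbitrary \<open>w0\<close> is harmless, because its boundary layer enters
  only through \<open>\<epsilon> D w0\<close>.

  The energy estimate has a second purpose. The fields are only locally Lipschitz, and it supplies
  the ball, common to all controls and to all small \<open>\<epsilon>\<close>, on which the
  Lipschitz constant of the reduced field is taken.

  Differential equations and inequalities hold almost everywhere only. Every estimate therefore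
  rests on one principle: an absolutely continuous function whose derivative is almost everywhere
  non-positive does not increase.\<close>

lemma abs_cont_nonincreasing:
  fixes f :: "real \<Rightarrow> real"
  assumes ab: "a \<le> b" and ac: "abs_cont_on a b f" and N: "negligible N"
    and f': "\<And>s. s \<in> {a..b} - N \<Longrightarrow> (f has_real_derivative f' s) (at s within {a..b})"
    and le: "\<And>s. s \<in> {a..b} - N \<Longrightarrow> f' s \<le> 0"
  shows "f b \<le> f a"
proof (rule field_le_epsilon)
  fix e' :: real
  assume "e' > 0"
  \<comment> \<open>The increment of \<open>f\<close> is summed over a tagged division that is fine
    for a suitable gauge. Intervals tagged outside \<open>N\<close> contribute at most
    \<open>e\<close> times their length, hence \<open>e * (b - a)\<close> in all; those tagged in
    \<open>N\<close> contribute at most \<open>e\<close> by absolute continuity. The summand 1 keeps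
    the denominator positive when \<open>a = b\<close>.\<close>
  define e where "e = e' / (b - a + 1)"
  have e: "e > 0" "e * (b - a) + e = e'"
    proof -
    have "b - a + 1 > 0" using ab by simp
    then show "e > 0" "e * (b - a) + e = e'"
      using \<open>e' > 0\<close> by (auto simp: e_def divide_simps) (simp add: algebra_simps)
  qed
  obtain d where d: "d > 0"
    and dac: "\<And>(n::nat) l r. \<lbrakk>\<And>i. i < n \<Longrightarrow> a \<le> l i \<and> l i \<le> r i \<and> r i \<le> b;
        disjoint_family_on (\<lambda>i. {l i<..<r i}) {..<n}; (\<Sum>i<n. r i - l i) < d\<rbrakk>
        \<Longrightarrow> (\<Sum>i<n. norm (f (r i) - f (l i))) < e"
    using ac \<open>e > 0\<close> unfolding abs_cont_on_def by meson
  obtain U where U: "N \<subseteq> U" "open U" "U \<in> lmeasurable" "measure lebesgue U < d"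
  proof -
    obtain U where U: "open U" "N \<subseteq> U" "U - N \<in> lmeasurable" "emeasure lebesgue (U - N) < ennreal d"
      using sets_lebesgue_outer_open[OF negligible_imp_sets[OF N] d] by metis
    have "N \<in> lmeasurable" using N by (rule negligible_imp_measurable)
    then have "(U - N) \<union> N \<in> lmeasurable" "measure lebesgue ((U - N) \<union> N) \<le> measure lebesgue (U - N) + measure lebesgue N"
      using U(3) measure_Un_le[OF fmeasurableD fmeasurableD] by blast+
    moreover have "(U - N) \<union> N = U" using U by auto
    moreover have "measure lebesgue (U - N) < d"
      using U d by (simp add: emeasure_eq_measure2 ennreal_less_iff)
    ultimately show ?thesis
      using that[of U] U N by (simp add: negligible_imp_measure0)
  qed
  define good where "good x r \<longleftrightarrow> r > 0 \<and> (\<forall>y\<in>{a..b}. \<bar>y - x\<bar> < r \<longrightarrow> \<bar>f y - f x - f' x * (y - x)\<bar> \<le> e * \<bar>y - x\<bar>)" for x r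
  have ex: "\<exists>r. good x r" if "x \<in> {a..b} - N" for x
    using f'[OF that] e(1) unfolding has_field_derivative_def has_derivative_within_alt good_def
    by (auto simp: mult.commute)
  define rr where "rr x = (SOME r. good x r)" for x
  have rr: "good x (rr x)" if "x \<in> {a..b} - N" for x
    unfolding rr_def using ex[OF that] by (rule someI_ex)
  \<comment> \<open>A tag in \<open>N\<close> forces its interval into \<open>U\<close>, whose
    measure is below \<open>d\<close>; a tag outside \<open>N\<close> keeps it where the linear
    approximation errs by at most \<open>e\<close> times the distance. The last case extends
    \<open>\<gamma>\<close> to a gauge on the whole line.\<close>
  define \<gamma> where "\<gamma> x = (if x \<in> N then U else if x \<in> {a..b} then ball x (rr x) else ball x 1)" for x
  have "gauge \<gamma>"
    using U rr unfolding gauge_def \<gamma>_def good_def by auto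
  then obtain p where p: "p tagged_division_of {a..b}" "\<gamma> fine p"
    by (rule fine_division_exists_real)
  note pD = tagged_division_ofD[OF p(1)]
  have K: "\<exists>l r. K = {l..r} \<and> a \<le> l \<and> l \<le> x \<and> x \<le> r \<and> r \<le> b" if xK: "(x,K) \<in> p" for x K
  proof -
    obtain l r where "K = {l..r}" using pD(4)[OF xK] by auto
    moreover have "x \<in> K" "K \<subseteq> {a..b}" using pD(2,3)[OF xK] by auto
    ultimately show ?thesis by auto
  qed
  define p1 where "p1 = {z \<in> p. fst z \<in> N}"
  define p2 where "p2 = {z \<in> p. fst z \<notin> N}"
  have p12: "p1 \<union> p2 = p" "p1 \<inter> p2 = {}" "finite p1" "finite p2"
    using pD(1) by (auto simp: p1_def p2_def)
  have "f b - f a = (\<Sum>(x,K)\<in>p. f (Sup K) - f (Inf K))"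
    using additive_tagged_division_1[OF ab p(1), of f] by simp
  also have "\<dots> = (\<Sum>(x,K)\<in>p1. f (Sup K) - f (Inf K)) + (\<Sum>(x,K)\<in>p2. f (Sup K) - f (Inf K))"
    using sum.union_disjoint[OF p12(3,4,2)] p12(1) by simp
  also have "(\<Sum>(x,K)\<in>p2. f (Sup K) - f (Inf K)) \<le> (\<Sum>(x,K)\<in>p2. e * measure lborel K)"
  proof (rule sum_mono, clarify)
    fix x K assume "(x,K) \<in> p2"
    then have xK: "(x,K) \<in> p" "x \<notin> N" by (auto simp: p2_def)
    obtain l r where lr: "K = {l..r}" "a \<le> l" "l \<le> x" "x \<le> r" "r \<le> b" using K[OF xK(1)] by auto
    have x: "x \<in> {a..b} - N" using lr xK by auto
    have "K \<subseteq> ball x (rr x)"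
      using p(2) xK x unfolding fine_def \<gamma>_def by fastforce
    moreover have "l \<in> K" "r \<in> K" using lr by auto
    ultimately have "\<bar>l - x\<bar> < rr x" "\<bar>r - x\<bar> < rr x"
      by (auto simp: subset_iff dist_real_def abs_minus_commute)
    moreover have "l \<in> {a..b}" "r \<in> {a..b}" using lr by auto
    ultimately have "\<bar>f l - f x - f' x * (l - x)\<bar> \<le> e * \<bar>l - x\<bar>" "\<bar>f r - f x - f' x * (r - x)\<bar> \<le> e * \<bar>r - x\<bar>"
      using rr[OF x] unfolding good_def by blast+
    \<comment> \<open>The tag lies in its interval, so the two one-sided errors add up to
      \<open>e\<close> times the length.\<close>
    moreover have "\<bar>l - x\<bar> = x - l" "\<bar>r - x\<bar> = r - x" using lr by auto
    ultimately have "- (f l - f x - f' x * (l - x)) \<le> e * (x - l)" "f r - f x - f' x * (r - x) \<le> e * (r - x)"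
      by (metis abs_le_iff)+
    then have "f r - f l - f' x * (r - l) \<le> e * (r - l)"
      by (simp add: algebra_simps)
    moreover have "f' x * (r - l) \<le> 0" using le[OF x] lr by (simp add: mult_nonpos_nonneg)
    ultimately show "f (Sup K) - f (Inf K) \<le> e * measure lborel K" using lr by simp
  qed
  also have "(\<Sum>(x,K)\<in>p2. e * measure lborel K) \<le> (\<Sum>(x,K)\<in>p. e * measure lborel K)"
    using pD(1) e by (intro sum_mono2) (auto simp: p2_def)
  also have "\<dots> = e * (b - a)"
    using additive_content_tagged_division[of p a b] p(1) ab
    by (simp add: sum_distrib_left[symmetric] split_def)
  also have "(\<Sum>(x,K)\<in>p1. f (Sup K) - f (Inf K)) \<le> e"
  proof -
    \<comment> \<open>\<open>abs_cont_on\<close> speaks of families indexed by an initial segment of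
      the naturals, hence the enumeration. The intervals do not overlap and lie in \<open>U\<close>,
      so their total length is below \<open>d\<close>.\<close>
    obtain h where h: "bij_betw h {..<card p1} p1"
      using p12(3) ex_bij_betw_nat_finite atLeast0LessThan by metis
    define l where "l i = Inf (snd (h i))" for i
    define r where "r i = Sup (snd (h i))" for i
    have hp: "h i \<in> p1" "h i \<in> p" if "i < card p1" for i
      using h that by (auto simp: bij_betw_def p1_def)
    have lr: "snd (h i) = {l i..r i} \<and> a \<le> l i \<and> l i \<le> r i \<and> r i \<le> b" if "i < card p1" for i
    proof -
      have "(fst (h i), snd (h i)) \<in> p" using hp that by simp
      from K[OF this] show ?thesis by (force simp: l_def r_def)
    qed
    have dj: "disjoint_family_on (\<lambda>i. {l i<..<r i}) {..<card p1}"
      unfolding disjoint_family_on_def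
    proof (intro ballI impI)
      fix i j assume ij: "i \<in> {..<card p1}" "j \<in> {..<card p1}" "i \<noteq> j"
      then have "h i \<noteq> h j" using h by (auto simp: bij_betw_def inj_on_def)
      then have "interior (snd (h i)) \<inter> interior (snd (h j)) = {}"
        using hp ij pD(5)[of "fst (h i)" "snd (h i)" "fst (h j)" "snd (h j)"] by auto
      then show "{l i<..<r i} \<inter> {l j<..<r j} = {}"
        using lr ij by simp
    qed
    have sub: "{l i<..<r i} \<subseteq> U" if "i < card p1" for i
    proof -
      have "(fst (h i), snd (h i)) \<in> p" "fst (h i) \<in> N" using hp that by (auto simp: p1_def)
      then have "snd (h i) \<subseteq> U" using p(2) unfolding fine_def \<gamma>_def by fastforce
      then show ?thesis using lr[OF that] by auto
    qed
    have "(\<Sum>i<card p1. r i - l i) = (\<Sum>i<card p1. measure lebesgue {l i<..<r i})"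
      using lr by (intro sum.cong) auto
    also have "\<dots> = measure lebesgue (\<Union>i<card p1. {l i<..<r i})"
      using dj lr by (intro measure_finite_Union[symmetric]) auto
    also have "\<dots> \<le> measure lebesgue U"
      using sub U by (intro measure_mono_fmeasurable) auto
    also have "\<dots> < d" by (rule U)
    finally have "(\<Sum>i<card p1. r i - l i) < d" .
    then have "(\<Sum>i<card p1. norm (f (r i) - f (l i))) < e"
      using lr dj by (intro dac) auto
    moreover have "(\<Sum>(x,K)\<in>p1. f (Sup K) - f (Inf K)) = (\<Sum>i<card p1. f (r i) - f (l i))"
      by (subst sum.reindex_bij_betw[OF h, symmetric]) (simp add: l_def r_def split_def)
    moreover have "\<dots> \<le> (\<Sum>i<card p1. norm (f (r i) - f (l i)))"
      by (rule sum_mono) simp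
    ultimately show ?thesis by simp
  qed
  finally show "f b \<le> f a + e'" using e by simp
qed

text \<open>A point where the derivative fails to be \<open>g x\<close> lies in some
  \<open>E k\<close>: at arbitrarily small scales the increment of the integral misses
  \<open>(y - x) *\<^sub>R g x\<close> by more than \<open>1 / (k + 1)\<close> times the length.
  Vitali selects disjoint balls covering almost all of \<open>E k\<close>; Henstock's lemma bounds
  the sum of the misses over finitely many disjoint intervals, hence also their total
  length.\<close>

lemma integral_has_vector_derivative_ae:
  fixes g :: "real \<Rightarrow> 'a::euclidean_space"
  assumes int: "g integrable_on {a..b}"
  shows "negligible {x \<in> {a..b}. \<not> ((\<lambda>t. integral {a..t} g) has_vector_derivative g x) (at x within {a..b})}"
proof -
  define I where "I t = integral {a..t} g" for t
  define E where "E k = {x \<in> {a..b}. \<forall>d>0. \<exists>y\<in>{a..b}. y \<noteq> x \<and> \<bar>y - x\<bar> < d \<and>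
      norm (I y - I x - (y - x) *\<^sub>R g x) > \<bar>y - x\<bar> / real (Suc k)}" for k
  have I_diff: "I y - I x = integral {x..y} g" if "a \<le> x" "x \<le> y" "y \<le> b" for x y
  proof -
    have "g integrable_on {a..y}"
      using int that by (metis atLeastatMost_subset_iff order_refl integrable_on_subinterval)
    then show ?thesis
      unfolding I_def using Henstock_Kurzweil_Integration.integral_combine[of a x y g] that
      by (simp add: algebra_simps)
  qed
  have "negligible (E k)" for k
    unfolding negligible_outer_le
  proof (intro allI impI)
    fix e :: real assume "e > 0"
    \<comment> \<open>The factor \<open>Suc k\<close> turns a bound on the misses into one on the
      lengths. The 2 accounts for the balls: centred at \<open>x\<close> with radius
      \<open>\<bar>y - x\<bar>\<close>, each is twice as long as the interval between
      \<open>x\<close> and \<open>y\<close>.\<close>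
    define e' where "e' = e / (2 * real (Suc k))"
    have "e' > 0" using \<open>e > 0\<close> by (simp add: e'_def)
    then obtain \<gamma> where \<gamma>: "gauge \<gamma>"
      and fine: "\<And>p. \<lbrakk>p tagged_partial_division_of (cbox a b); \<gamma> fine p\<rbrakk> \<Longrightarrow>
             sum (\<lambda>(x,k). norm(measure lborel k *\<^sub>R g x - integral k g)) p < e'"
      using Henstock_lemma[of g a b e'] int by auto
    \<comment> \<open>A pair holds a tag and the far end of a bad interval. Vitali sees the ball
      around the tag and Henstock the one-sided interval inside it; disjoint balls give disjoint
      intervals.\<close>
    define K where "K = {(x,y). x \<in> E k \<and> y \<in> {a..b} \<and> y \<noteq> x \<and> {min x y..max x y} \<subseteq> \<gamma> x \<and>
       norm (I y - I x - (y - x) *\<^sub>R g x) > \<bar>y - x\<bar> / real (Suc k)}"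
    have pos: "0 < \<bar>snd i - fst i\<bar>" if "i \<in> K" for i
      using that by (auto simp: K_def)
    have cov: "\<exists>i. i \<in> K \<and> x \<in> cball (fst i) \<bar>snd i - fst i\<bar> \<and> \<bar>snd i - fst i\<bar> < d"
      if xd: "x \<in> E k" "0 < d" for x d
    proof -
      obtain r where r: "r > 0" "ball x r \<subseteq> \<gamma> x"
        using \<gamma> openE unfolding gauge_def by metis
      obtain y where y: "y\<in>{a..b}" "y \<noteq> x" "\<bar>y - x\<bar> < min d r"
          "norm (I y - I x - (y - x) *\<^sub>R g x) > \<bar>y - x\<bar> / real (Suc k)"
      proof -
        have "min d r > 0" using xd r by simp
        with xd(1) show ?thesis
          using that unfolding E_def by blast
      qed
      have "{min x y..max x y} \<subseteq> ball x r"
        using y by (auto simp: dist_real_def min_def max_def split: if_splits)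
      with r y xd show ?thesis
        by (intro exI[of _ "(x,y)"]) (auto simp: K_def)
    qed
    obtain C where C: "countable C" "C \<subseteq> K"
     and dj: "pairwise (\<lambda>i j. disjnt (cball (fst i) \<bar>snd i - fst i\<bar>) (cball (fst j) \<bar>snd j - fst j\<bar>)) C"
     and neg: "negligible(E k - (\<Union>i \<in> C. cball (fst i) \<bar>snd i - fst i\<bar>))"
      by (rule Vitali_covering_theorem_cballs[of K "\<lambda>i. \<bar>snd i - fst i\<bar>" "E k" fst, OF pos cov])
    define cb where "cb i = cball (fst i) \<bar>snd i - fst i\<bar>" for i :: "real \<times> real"
    have fin: "measure lebesgue (\<Union>i\<in>D. cb i) \<le> e" if D: "D \<subseteq> C" "finite D" for D
    proof -
      define J where "J i = (fst i, cbox (min (fst i) (snd i)) (max (fst i) (snd i)))" for i :: "real \<times> real"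
      have J_sub: "snd (J i) \<subseteq> cb i" for i
        by (auto simp: J_def cb_def dist_real_def min_def max_def split: if_splits)
      have DK: "D \<subseteq> K" using D C by auto
      have disj: "snd (J i) \<inter> snd (J j) = {}" if "i \<in> D" "j \<in> D" "i \<noteq> j" for i j
        using dj that D J_sub unfolding pairwise_def disjnt_def cb_def by blast
      have inj: "inj_on J D"
      proof (rule inj_onI, rule ccontr)
        fix i j assume "i \<in> D" "j \<in> D" "J i = J j" "i \<noteq> j"
        then have "snd (J i) = {}" using disj[of i j] by auto
        then show False by (auto simp: J_def)
      qed
      have part: "J ` D tagged_partial_division_of (cbox a b)"
        unfolding tagged_partial_division_of_def
      proof (intro conjI allI impI)
        show "finite (J ` D)" using D by simp
      next
        fix x k assume xk: "(x,k) \<in> J ` D"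
        then obtain i where i: "i \<in> D" "(x,k) = J i" by auto
        then have "i \<in> K" using DK by auto
        then show "x \<in> k" "k \<subseteq> cbox a b" "\<exists>a b. k = cbox a b"
          using i by (auto simp: J_def K_def E_def)
      next
        fix x1 K1 x2 K2
        assume "(x1, K1) \<in> J ` D \<and> (x2, K2) \<in> J ` D \<and> (x1, K1) \<noteq> (x2, K2)"
        then have "K1 \<inter> K2 = {}" using disj by (metis imageE snd_conv)
        then show "interior K1 \<inter> interior K2 = {}"
          using interior_subset by blast
      qed
      have finef: "\<gamma> fine (J ` D)"
        using DK by (fastforce simp: fine_def J_def K_def)
      have tm: "\<bar>snd i - fst i\<bar> / real (Suc k) \<le>
          (\<lambda>(x,k). norm(measure lborel k *\<^sub>R g x - integral k g)) (J i)" if "i \<in> D" for i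
      proof -
        obtain x y where i: "i = (x,y)" by force
        with that DK have K: "(x,y) \<in> K" by auto
        then have bad: "norm (I y - I x - (y - x) *\<^sub>R g x) > \<bar>y - x\<bar> / real (Suc k)"
          and ab: "x \<in> {a..b}" "y \<in> {a..b}"
          by (auto simp: K_def E_def)
        show ?thesis
        proof (cases "x \<le> y")
          case True
          then show ?thesis using bad ab I_diff[of x y]
            by (simp add: i J_def norm_minus_commute)
        next
          case False
          then have "I y - I x - (y - x) *\<^sub>R g x = (x - y) *\<^sub>R g x - integral {y..x} g"
            using ab I_diff[of y x] by (simp add: algebra_simps)
          then show ?thesis using bad False by (simp add: i J_def)
        qed
      qed
      have "(\<Sum>i\<in>D. \<bar>snd i - fst i\<bar>) / real (Suc k) \<le>
          (\<Sum>i\<in>D. (\<lambda>(x,k). norm(measure lborel k *\<^sub>R g x - integral k g)) (J i))"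
        unfolding sum_divide_distrib by (rule sum_mono) (rule tm)
      also have "\<dots> < e'"
        using fine[OF part finef] by (simp add: sum.reindex[OF inj] o_def)
      finally have "(\<Sum>i\<in>D. \<bar>snd i - fst i\<bar>) / real (Suc k) < (e / 2) / real (Suc k)"
        by (simp add: e'_def)
      then have le: "2 * (\<Sum>i\<in>D. \<bar>snd i - fst i\<bar>) \<le> e"
        by (subst (asm) divide_less_cancel) (auto split: if_splits)
      have "measure lebesgue (\<Union>i\<in>D. cb i) \<le> (\<Sum>i\<in>D. measure lebesgue (cb i))"
        by (rule measure_UNION_le) (auto simp: D cb_def)
      also have "\<dots> = 2 * (\<Sum>i\<in>D. \<bar>snd i - fst i\<bar>)"
        unfolding sum_distrib_left
        by (rule sum.cong) (auto simp: cb_def cball_eq_atLeastAtMost)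
      finally show ?thesis using le by simp
    qed
    \<comment> \<open>Henstock's lemma handles finite families; as the bound \<open>e\<close> is the
      same for all of them, it passes to the countable union.\<close>
    have "(\<Union>i\<in>C. cb i) \<in> lmeasurable \<and> measure lebesgue (\<Union>i\<in>C. cb i) \<le> e"
      proof
      have m: "cb i \<in> lmeasurable" for i by (simp add: cb_def)
      show "(\<Union>i\<in>C. cb i) \<in> lmeasurable" by (rule fmeasurable_UN_bound[OF C(1) m fin])
      show "measure lebesgue (\<Union>i\<in>C. cb i) \<le> e" by (rule measure_UN_bound[OF C(1) m fin])
    qed
    then show "\<exists>T. E k \<subseteq> T \<and> T \<in> lmeasurable \<and> measure lebesgue T \<le> e"
    proof (intro exI conjI)
      let ?N = "E k - (\<Union>i\<in>C. cb i)"
      have neg': "negligible ?N" using neg by (simp add: cb_def)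
      assume *: "(\<Union>i\<in>C. cb i) \<in> lmeasurable \<and> measure lebesgue (\<Union>i\<in>C. cb i) \<le> e"
      show "E k \<subseteq> (\<Union>i\<in>C. cb i) \<union> ?N" by auto
      show "(\<Union>i\<in>C. cb i) \<union> ?N \<in> lmeasurable"
        using * by (intro fmeasurable.Un[OF _ negligible_imp_measurable[OF neg']]) simp
      have "measure lebesgue ((\<Union>i\<in>C. cb i) \<union> ?N) \<le> measure lebesgue (\<Union>i\<in>C. cb i) + measure lebesgue ?N"
        using * by (intro measure_Un_le[OF fmeasurableD negligible_imp_sets[OF neg']]) simp
      then show "measure lebesgue ((\<Union>i\<in>C. cb i) \<union> ?N) \<le> e"
        using * negligible_imp_measure0[OF neg'] by simp
    qed
  qed
  then have "negligible (\<Union>k. E k)"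
    by (rule negligible_Union_nat)
  moreover have "{x \<in> {a..b}. \<not> (I has_vector_derivative g x) (at x within {a..b})} \<subseteq> (\<Union>k. E k)"
  proof clarify
    fix x assume x: "x \<in> {a..b}" and nd: "\<not> (I has_vector_derivative g x) (at x within {a..b})"
    then obtain e where e: "e > 0" and bad: "\<And>d. d > 0 \<Longrightarrow> \<exists>y\<in>{a..b}. \<bar>y - x\<bar> < d \<and> norm (I y - I x - (y - x) *\<^sub>R g x) > e * \<bar>y - x\<bar>"
      unfolding has_vector_derivative_def has_derivative_within_alt
      by (auto simp: bounded_linear_scaleR_left not_le)
    obtain k where k: "1 / real (Suc k) < e"
      using e reals_Archimedean by (metis inverse_eq_divide)
    have "x \<in> E k"
      unfolding E_def
    proof (intro CollectI conjI allI impI x)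
      fix d :: real assume "d > 0"
      from bad[OF this] obtain y where y: "y \<in> {a..b}" "\<bar>y - x\<bar> < d" "norm (I y - I x - (y - x) *\<^sub>R g x) > e * \<bar>y - x\<bar>"
        by auto
      have "\<bar>y - x\<bar> / real (Suc k) \<le> e * \<bar>y - x\<bar>"
        using mult_right_mono[of "1 / real (Suc k)" e "\<bar>y - x\<bar>"] k by simp
      moreover have "y \<noteq> x" using y by auto
      ultimately show "\<exists>y\<in>{a..b}. y \<noteq> x \<and> \<bar>y - x\<bar> < d \<and> \<bar>y - x\<bar> / real (Suc k) < norm (I y - I x - (y - x) *\<^sub>R g x)"
        using y by (intro bexI[of _ y]) auto
    qed
    then show "x \<in> (\<Union>k. E k)" by auto
  qed
  ultimately show ?thesis
    unfolding I_def[symmetric] by (rule negligible_subset)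
qed

section \<open>Null sets and closure properties of absolute continuity\<close>

lemma AE_lebesgue_on_iff_negligible:
  assumes "S \<in> sets lebesgue"
  shows "(AE x in lebesgue_on S. P x) \<longleftrightarrow> negligible {x \<in> S. \<not> P x}"
proof -
  have "(AE x in lebesgue_on S. P x) \<longleftrightarrow> (AE x in lebesgue. x \<in> S \<longrightarrow> P x)"
    using assms by (simp add: AE_restrict_space_iff)
  also have "\<dots> \<longleftrightarrow> (\<exists>N. negligible N \<and> {x \<in> S. \<not> P x} \<subseteq> N)"
    by (auto simp: eventually_ae_filter negligible_iff_null_sets)
  also have "\<dots> \<longleftrightarrow> negligible {x \<in> S. \<not> P x}"
    using negligible_subset by blast
  finally show ?thesis .
qed

text \<open>Lipschitz maps, pairs, bounded linear images and inner products all have increments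
  controlled by those of absolutely continuous functions, so their epsilon-delta argument is carried
  out once, here.\<close>

lemma abs_cont_on_dominated:
  fixes f :: "real \<Rightarrow> 'a::real_normed_vector" and g :: "real \<Rightarrow> 'b::real_normed_vector"
    and h :: "real \<Rightarrow> 'c::real_normed_vector"
  assumes g: "abs_cont_on a b g" and h: "abs_cont_on a b h"
    and le: "\<And>l r. a \<le> l \<Longrightarrow> l \<le> r \<Longrightarrow> r \<le> b \<Longrightarrow>
      norm (f r - f l) \<le> K * (norm (g r - g l) + norm (h r - h l))"
  shows "abs_cont_on a b f"
  unfolding abs_cont_on_def
proof (intro allI impI)
  fix e :: real assume "e > 0"
  \<comment> \<open>Strictly larger than \<open>\<bar>K\<bar>\<close>, so that the final bound by
    \<open>e\<close> is strict even when \<open>K = 0\<close>.\<close>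
  define c where "c = \<bar>K\<bar> + 1"
  have c: "c > 0" "\<bar>K\<bar> < c" by (auto simp: c_def)
  define e' where "e' = e / 2 / c"
  have e': "e' > 0" using \<open>e > 0\<close> c by (simp add: e'_def)
  obtain d1 where d1: "d1 > 0"
    "\<And>(n::nat) l r. (\<forall>i<n. a \<le> l i \<and> l i \<le> r i \<and> r i \<le> b) \<and>
        disjoint_family_on (\<lambda>i. {l i<..<r i}) {..<n} \<and> (\<Sum>i<n. r i - l i) < d1 \<longrightarrow>
        (\<Sum>i<n. norm (g (r i) - g (l i))) < e'"
    using g e' unfolding abs_cont_on_def by meson
  obtain d2 where d2: "d2 > 0"
    "\<And>(n::nat) l r. (\<forall>i<n. a \<le> l i \<and> l i \<le> r i \<and> r i \<le> b) \<and>
        disjoint_family_on (\<lambda>i. {l i<..<r i}) {..<n} \<and> (\<Sum>i<n. r i - l i) < d2 \<longrightarrow>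
        (\<Sum>i<n. norm (h (r i) - h (l i))) < e'"
    using h e' unfolding abs_cont_on_def by meson
  show "\<exists>d>0. \<forall>(n::nat) l r. (\<forall>i<n. a \<le> l i \<and> l i \<le> r i \<and> r i \<le> b) \<and>
        disjoint_family_on (\<lambda>i. {l i<..<r i}) {..<n} \<and> (\<Sum>i<n. r i - l i) < d \<longrightarrow>
        (\<Sum>i<n. norm (f (r i) - f (l i))) < e"
  proof (intro exI[of _ "min d1 d2"] conjI allI impI)
    show "min d1 d2 > 0" using d1 d2 by simp
    fix n :: nat and l r
    assume *: "(\<forall>i<n. a \<le> l i \<and> l i \<le> r i \<and> r i \<le> b) \<and>
        disjoint_family_on (\<lambda>i. {l i<..<r i}) {..<n} \<and> (\<Sum>i<n. r i - l i) < min d1 d2"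
    have 1: "(\<Sum>i<n. norm (g (r i) - g (l i))) < e'" using d1(2)[of n l r] * by simp
    have 2: "(\<Sum>i<n. norm (h (r i) - h (l i))) < e'" using d2(2)[of n l r] * by simp
    have "(\<Sum>i<n. norm (f (r i) - f (l i)))
        \<le> (\<Sum>i<n. \<bar>K\<bar> * (norm (g (r i) - g (l i)) + norm (h (r i) - h (l i))))"
    proof (rule sum_mono)
      fix i assume "i \<in> {..<n}"
      then have "norm (f (r i) - f (l i)) \<le> K * (norm (g (r i) - g (l i)) + norm (h (r i) - h (l i)))"
        using * by (intro le) auto
      also have "\<dots> \<le> \<bar>K\<bar> * (norm (g (r i) - g (l i)) + norm (h (r i) - h (l i)))"
        by (intro mult_right_mono) auto
      finally show "norm (f (r i) - f (l i)) \<le> \<bar>K\<bar> * (norm (g (r i) - g (l i)) + norm (h (r i) - h (l i)))" .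
    qed
    also have "\<dots> = \<bar>K\<bar> * ((\<Sum>i<n. norm (g (r i) - g (l i))) + (\<Sum>i<n. norm (h (r i) - h (l i))))"
      by (simp add: sum_distrib_left[symmetric] sum.distrib)
    also have "\<dots> \<le> \<bar>K\<bar> * (2 * e')" using 1 2 by (intro mult_left_mono) auto
    also have "\<dots> < c * (2 * e')" using e' c by simp
    also have "\<dots> = e" using c by (simp add: e'_def)
    finally show "(\<Sum>i<n. norm (f (r i) - f (l i))) < e" .
  qed
qed

lemma abs_cont_on_ident: "abs_cont_on a b (\<lambda>t::real. t)"
  unfolding abs_cont_on_def
proof (intro allI impI)
  fix e :: real assume "e > 0"
  then show "\<exists>d>0. \<forall>(n::nat) l r. (\<forall>i<n. a \<le> l i \<and> l i \<le> r i \<and> r i \<le> b) \<and>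
        disjoint_family_on (\<lambda>i. {l i<..<r i}) {..<n} \<and> (\<Sum>i<n. r i - l i) < d \<longrightarrow>
        (\<Sum>i<n. norm (r i - l i)) < e"
    by (intro exI[of _ e] conjI allI impI) (auto cong: sum.cong_simp)
qed

lemma abs_cont_on_lipschitz:
  fixes f :: "real \<Rightarrow> 'a::real_normed_vector"
  assumes "K-lipschitz_on {a..b} f"
  shows "abs_cont_on a b f"
proof (rule abs_cont_on_dominated[OF abs_cont_on_ident abs_cont_on_ident])
  fix l r assume "a \<le> l" "l \<le> r" "r \<le> b"
  then have "norm (f r - f l) \<le> K * norm (r - l)"
    using assms by (auto dest!: lipschitz_onD[of _ _ _ r l] simp: dist_norm)
  also have "\<dots> \<le> K * (norm (r - l) + norm (r - l))"
    using lipschitz_on_nonneg[OF assms] by (intro mult_left_mono) auto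
  finally show "norm (f r - f l) \<le> K * (norm (r - l) + norm (r - l))" .
qed

lemma abs_cont_on_subinterval:
  assumes "abs_cont_on a b f" "a \<le> c" "d \<le> b"
  shows "abs_cont_on c d f"
proof -
  have *: "(\<forall>i<n. a \<le> l i \<and> l i \<le> r i \<and> r i \<le> b)" if "(\<forall>i<n. c \<le> l i \<and> l i \<le> r i \<and> r i \<le> d)" for n l r
    using that assms(2,3) by (meson order_trans)
  show ?thesis
    unfolding abs_cont_on_def
  proof (intro allI impI)
    fix e :: real assume "e > 0"
    then obtain \<delta> where \<delta>: "\<delta> > 0"
      "\<And>(n::nat) l r. (\<forall>i<n. a \<le> l i \<and> l i \<le> r i \<and> r i \<le> b) \<and>
          disjoint_family_on (\<lambda>i. {l i<..<r i}) {..<n} \<and> (\<Sum>i<n. r i - l i) < \<delta> \<longrightarrow>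
          (\<Sum>i<n. norm (f (r i) - f (l i))) < e"
      using assms(1) unfolding abs_cont_on_def by meson
    show "\<exists>\<delta>>0. \<forall>(n::nat) l r. (\<forall>i<n. c \<le> l i \<and> l i \<le> r i \<and> r i \<le> d) \<and>
          disjoint_family_on (\<lambda>i. {l i<..<r i}) {..<n} \<and> (\<Sum>i<n. r i - l i) < \<delta> \<longrightarrow>
          (\<Sum>i<n. norm (f (r i) - f (l i))) < e"
      by (intro exI[of _ \<delta>] conjI \<delta>(1) allI impI, rule \<delta>(2)[rule_format]) (use * in blast)
  qed
qed

lemma abs_cont_on_imp_continuous_on:
  fixes f :: "real \<Rightarrow> 'a::real_normed_vector"
  assumes "abs_cont_on a b f"
  shows "continuous_on {a..b} f"
  unfolding continuous_on_iff
proof (intro ballI allI impI)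
  fix x e :: real assume x: "x \<in> {a..b}" "e > 0"
  obtain d where d: "d > 0"
    "\<And>(n::nat) l r. (\<forall>i<n. a \<le> l i \<and> l i \<le> r i \<and> r i \<le> b) \<and>
        disjoint_family_on (\<lambda>i. {l i<..<r i}) {..<n} \<and> (\<Sum>i<n. r i - l i) < d \<longrightarrow>
        (\<Sum>i<n. norm (f (r i) - f (l i))) < e"
    using assms x unfolding abs_cont_on_def by meson
  show "\<exists>d>0. \<forall>x'\<in>{a..b}. dist x' x < d \<longrightarrow> dist (f x') (f x) < e"
  proof (intro exI[of _ d] conjI d ballI impI)
    fix y assume y: "y \<in> {a..b}" "dist y x < d"
    show "dist (f y) (f x) < e"
      using d(2)[of 1 "\<lambda>_. min x y" "\<lambda>_. max x y"] x y
      by (auto simp: disjoint_family_on_def dist_norm min_def max_def norm_minus_commute split: if_splits)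
  qed
qed

lemma abs_cont_on_Pair:
  assumes "abs_cont_on a b f" "abs_cont_on a b g"
  shows "abs_cont_on a b (\<lambda>t. (f t, g t))"
  by (rule abs_cont_on_dominated[OF assms, where K = 1]) (simp add: norm_Pair_le)

lemma abs_cont_on_bounded_linear:
  assumes "bounded_linear A" "abs_cont_on a b f"
  shows "abs_cont_on a b (\<lambda>t. A (f t))"
proof -
  interpret A: bounded_linear A by fact
  obtain K where K: "K > 0" "\<And>x. norm (A x) \<le> norm x * K" using A.pos_bounded by auto
  show ?thesis
  proof (rule abs_cont_on_dominated[OF assms(2,2), where K = K])
    fix l r
    have "norm (A (f r) - A (f l)) \<le> norm (f r - f l) * K" using K(2)[of "f r - f l"] by (simp add: A.diff)
    also have "\<dots> \<le> K * (norm (f r - f l) + norm (f r - f l))" using K(1) by simp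
    finally show "norm (A (f r) - A (f l)) \<le> K * (norm (f r - f l) + norm (f r - f l))" .
  qed
qed

lemma abs_cont_on_inner:
  fixes f g :: "real \<Rightarrow> 'a::real_inner"
  assumes f: "abs_cont_on a b f" and g: "abs_cont_on a b g"
  shows "abs_cont_on a b (\<lambda>t. f t \<bullet> g t)"
proof -
  have "bounded (f ` {a..b})" "bounded (g ` {a..b})"
    using f g by (auto intro!: compact_imp_bounded compact_continuous_image abs_cont_on_imp_continuous_on)
  then obtain B C where B: "\<forall>t\<in>{a..b}. norm (f t) \<le> B" and C: "\<forall>t\<in>{a..b}. norm (g t) \<le> C"
    unfolding bounded_iff by auto
  show ?thesis
  proof (rule abs_cont_on_dominated[OF f g, where K = "max B C"])
    fix l r assume lr: "a \<le> l" "l \<le> r" "r \<le> b"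
    have "f r \<bullet> g r - f l \<bullet> g l = (f r - f l) \<bullet> g r + f l \<bullet> (g r - g l)"
      by (simp add: inner_diff_left inner_diff_right)
    also have "norm \<dots> \<le> norm (f r - f l) * norm (g r) + norm (f l) * norm (g r - g l)"
      by (metis norm_triangle_mono Cauchy_Schwarz_ineq2 real_norm_def)
    also have "\<dots> \<le> norm (f r - f l) * max B C + max B C * norm (g r - g l)"
      using bspec[OF B, of l] bspec[OF C, of r] lr
      by (intro add_mono mult_left_mono mult_right_mono) (auto simp: le_max_iff_disj)
    finally show "norm (f r \<bullet> g r - f l \<bullet> g l) \<le> max B C * (norm (f r - f l) + norm (g r - g l))"
      by (simp add: algebra_simps)
  qed
qed

subsection \<open>Caratheodory solutions and Gronwall estimates\<close>

text \<open>Monotonicity and the scalar Gronwall bound are stated at the right endpoint; restriction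
  carries them to every intermediate time.\<close>

lemma caratheodory_subinterval:
  assumes x: "caratheodory T g x0 x" and t: "0 \<le> t" "t \<le> T"
  shows "caratheodory t g x0 x"
proof -
  have "negligible {s \<in> {0..T}. \<not> (x has_vector_derivative g s) (at s within {0..T})}"
    using x by (simp add: caratheodory_def AE_lebesgue_on_iff_negligible)
  moreover have "{s \<in> {0..t}. \<not> (x has_vector_derivative g s) (at s within {0..t})}
      \<subseteq> {s \<in> {0..T}. \<not> (x has_vector_derivative g s) (at s within {0..T})}"
    using t by (auto intro: has_vector_derivative_within_subset[where T="{0..t}"])
  ultimately have "negligible {s \<in> {0..t}. \<not> (x has_vector_derivative g s) (at s within {0..t})}"
    by (rule negligible_subset)
  then show ?thesis
    using x t abs_cont_on_subinterval[of 0 T x 0 t]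
    by (simp add: caratheodory_def AE_lebesgue_on_iff_negligible)
qed

lemma caratheodory_cong_AE:
  assumes x: "caratheodory T g x0 x" and "AE s in lebesgue_on {0..T}. g s = h s"
  shows "caratheodory T h x0 x"
proof -
  have "AE s in lebesgue_on {0..T}. (x has_vector_derivative g s) (at s within {0..T})"
    using x by (simp add: caratheodory_def)
  then have "AE s in lebesgue_on {0..T}. (x has_vector_derivative h s) (at s within {0..T})"
    using assms(2) by eventually_elim simp
  then show ?thesis using x by (simp add: caratheodory_def)
qed

lemma caratheodory_Pair:
  assumes x: "caratheodory T g x0 x" and y: "caratheodory T h y0 y"
  shows "caratheodory T (\<lambda>s. (g s, h s)) (x0, y0) (\<lambda>s. (x s, y s))"
proof -
  have "AE s in lebesgue_on {0..T}. (x has_vector_derivative g s) (at s within {0..T})"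
    "AE s in lebesgue_on {0..T}. (y has_vector_derivative h s) (at s within {0..T})"
    using x y by (simp_all add: caratheodory_def)
  then have "AE s in lebesgue_on {0..T}. ((\<lambda>s. (x s, y s)) has_vector_derivative (g s, h s)) (at s within {0..T})"
    by eventually_elim (rule has_vector_derivative_Pair)
  then show ?thesis using x y by (simp add: caratheodory_def abs_cont_on_Pair)
qed

lemma caratheodory_bounded_linear:
  assumes A: "bounded_linear A" and x: "caratheodory T g x0 x"
  shows "caratheodory T (\<lambda>s. A (g s)) (A x0) (\<lambda>s. A (x s))"
proof -
  have "AE s in lebesgue_on {0..T}. (x has_vector_derivative g s) (at s within {0..T})"
    using x by (simp_all add: caratheodory_def)
  then have "AE s in lebesgue_on {0..T}. ((\<lambda>s. A (x s)) has_vector_derivative A (g s)) (at s within {0..T})"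
    by eventually_elim (rule bounded_linear.has_vector_derivative[OF A])
  then show ?thesis using x A by (auto simp: caratheodory_def abs_cont_on_bounded_linear)
qed

lemma caratheodory_add:
  assumes x: "caratheodory T g x0 x" and y: "caratheodory T h y0 y"
  shows "caratheodory T (\<lambda>s. g s + h s) (x0 + y0) (\<lambda>s. x s + y s)"
  using caratheodory_bounded_linear[OF _ caratheodory_Pair[OF x y], of "\<lambda>z. fst z + snd z"]
  by (simp add: bounded_linear_add bounded_linear_fst bounded_linear_snd)

lemma caratheodory_diff:
  assumes x: "caratheodory T g x0 x" and y: "caratheodory T h y0 y"
  shows "caratheodory T (\<lambda>s. g s - h s) (x0 - y0) (\<lambda>s. x s - y s)"
  using caratheodory_bounded_linear[OF _ caratheodory_Pair[OF x y], of "\<lambda>z. fst z - snd z"]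
  by (simp add: bounded_linear_sub bounded_linear_fst bounded_linear_snd)

lemma caratheodory_inner:
  fixes x y :: "real \<Rightarrow> 'a::real_inner"
  assumes x: "caratheodory T g x0 x" and y: "caratheodory T h y0 y"
  shows "caratheodory T (\<lambda>s. x s \<bullet> h s + g s \<bullet> y s) (x0 \<bullet> y0) (\<lambda>s. x s \<bullet> y s)"
proof -
  have "AE s in lebesgue_on {0..T}. (x has_vector_derivative g s) (at s within {0..T})"
    "AE s in lebesgue_on {0..T}. (y has_vector_derivative h s) (at s within {0..T})"
    using x y by (simp_all add: caratheodory_def)
  then have "AE s in lebesgue_on {0..T}. ((\<lambda>s. x s \<bullet> y s) has_vector_derivative (x s \<bullet> h s + g s \<bullet> y s)) (at s within {0..T})"
    by eventually_elim (rule bounded_bilinear.has_vector_derivative[OF bounded_bilinear_inner])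
  then show ?thesis using x y by (auto simp: caratheodory_def abs_cont_on_inner)
qed

lemma caratheodory_nonincreasing:
  fixes x :: "real \<Rightarrow> real"
  assumes T: "0 \<le> T" and x: "caratheodory T g x0 x" and le: "AE s in lebesgue_on {0..T}. g s \<le> 0"
  shows "x T \<le> x0"
proof -
  let ?P = "\<lambda>s. (x has_vector_derivative g s) (at s within {0..T}) \<and> g s \<le> 0"
  have "AE s in lebesgue_on {0..T}. (x has_vector_derivative g s) (at s within {0..T})"
    using x by (simp_all add: caratheodory_def)
  then have "AE s in lebesgue_on {0..T}. ?P s"
    using le by eventually_elim simp
  then have N: "negligible {s \<in> {0..T}. \<not> ?P s}"
    by (rule AE_lebesgue_on_iff_negligible[THEN iffD1, rotated]) simp
  have "x T \<le> x 0"
    using x by (intro abs_cont_nonincreasing[OF T _ N, where f' = g])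
      (auto simp: caratheodory_def has_real_derivative_iff_has_vector_derivative)
  then show ?thesis using x by (simp add: caratheodory_def)
qed

text \<open>Brings smooth functions into the Caratheodory calculus: the integrating factor
  \<open>exp (- K * s)\<close> and the constants that are added to energies.\<close>

lemma caratheodory_deriv:
  fixes f :: "real \<Rightarrow> 'a::real_normed_vector"
  assumes f: "\<And>s. s \<in> {0..T} \<Longrightarrow> (f has_vector_derivative f' s) (at s within {0..T})"
    and f': "continuous_on {0..T} f'"
  shows "caratheodory T f' (f 0) f"
proof -
  have "bounded (f' ` {0..T})" by (intro compact_imp_bounded compact_continuous_image f') simp
  then obtain B where B: "\<forall>s\<in>{0..T}. norm (f' s) \<le> B" unfolding bounded_iff by auto
  have "\<bar>B\<bar>-lipschitz_on {0..T} f"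
  proof (rule bounded_derivative_imp_lipschitz)
    show "(f has_derivative (\<lambda>h. h *\<^sub>R f' s)) (at s within {0..T})" if "s \<in> {0..T}" for s
      using f[OF that] by (simp add: has_vector_derivative_def)
    show "onorm (\<lambda>h. h *\<^sub>R f' s) \<le> \<bar>B\<bar>" if "s \<in> {0..T}" for s
    proof (rule onorm_bound)
      have "norm (f' s) \<le> \<bar>B\<bar>" using bspec[OF B that] by simp
      then show "norm (h *\<^sub>R f' s) \<le> \<bar>B\<bar> * norm h" for h
        using mult_left_mono[of "norm (f' s)" "\<bar>B\<bar>" "norm h"] by (simp add: mult.commute)
    qed simp
  qed auto
  then show ?thesis
    using f abs_cont_on_lipschitz by (auto simp: caratheodory_def intro!: AE_I2)
qed

text \<open>Integrating factor: \<open>x s * exp (- K * s)\<close> has a non-positive derivative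
  almost everywhere.\<close>

lemma caratheodory_scalar_gronwall:
  fixes x :: "real \<Rightarrow> real"
  assumes T: "0 \<le> T" and x: "caratheodory T g x0 x"
    and le: "AE s in lebesgue_on {0..T}. g s \<le> K * x s"
  shows "x T \<le> exp (K * T) * x0"
proof -
  have "caratheodory T (\<lambda>s. - K * exp (- K * s)) (exp (- K * 0)) (\<lambda>s. exp (- K * s))"
    by (rule caratheodory_deriv)
      (auto intro!: derivative_eq_intros continuous_intros simp: has_real_derivative_iff_has_vector_derivative[symmetric])
  from caratheodory_inner[OF x this]
  have "caratheodory T (\<lambda>s. x s * (- K * exp (- K * s)) + g s * exp (- K * s)) x0 (\<lambda>s. x s * exp (- K * s))"
    by simp
  moreover have "AE s in lebesgue_on {0..T}. x s * (- K * exp (- K * s)) + g s * exp (- K * s) \<le> 0"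
    using le
  proof eventually_elim
    case (elim s)
    then have "(g s - K * x s) * exp (- K * s) \<le> 0" by (intro mult_nonpos_nonneg) auto
    then show ?case by (simp add: algebra_simps)
  qed
  ultimately have "x T * exp (- K * T) \<le> x0" by (rule caratheodory_nonincreasing[OF T])
  then have "exp (K * T) * (x T * exp (- K * T)) \<le> exp (K * T) * x0" by simp
  then show ?thesis by (simp add: mult.left_commute exp_add[symmetric])
qed

text \<open>The norm is not differentiable at 0, so its square is used. Adding the constant
  \<open>\<eta>\<^sup>2\<close> absorbs the inhomogeneous term: from
  \<open>2 * norm x * \<eta> \<le> (norm x)\<^sup>2 + \<eta>\<^sup>2\<close> the sum satisfies a
  homogeneous inequality with rate \<open>3 * L\<close>, two parts from the quadratic term and one
  from the mixed term.\<close>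

lemma caratheodory_gronwall:
  fixes x :: "real \<Rightarrow> 'a::real_inner"
  assumes x: "caratheodory T g x0 x" and L: "0 \<le> L" and t: "0 \<le> t" "t \<le> T"
    and le: "AE s in lebesgue_on {0..T}. norm (g s) \<le> L * (norm (x s) + \<eta>)" and \<eta>: "0 \<le> \<eta>"
  shows "(norm (x t))\<^sup>2 + \<eta>\<^sup>2 \<le> exp (3 * L * T) * ((norm x0)\<^sup>2 + \<eta>\<^sup>2)"
proof -
  have xt: "caratheodory t g x0 x" by (rule caratheodory_subinterval[OF x t])
  have "negligible {s \<in> {0..T}. \<not> norm (g s) \<le> L * (norm (x s) + \<eta>)}"
    using le by (simp add: AE_lebesgue_on_iff_negligible)
  then have "negligible {s \<in> {0..t}. \<not> norm (g s) \<le> L * (norm (x s) + \<eta>)}"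
    by (rule negligible_subset) (use t in auto)
  then have le': "AE s in lebesgue_on {0..t}. norm (g s) \<le> L * (norm (x s) + \<eta>)"
    by (simp add: AE_lebesgue_on_iff_negligible)
  have c: "caratheodory t (\<lambda>s. 0) (\<eta>\<^sup>2) (\<lambda>s. \<eta>\<^sup>2)"
    using caratheodory_deriv[of t "\<lambda>s. \<eta>\<^sup>2" "\<lambda>s. 0"] by simp
  have "(x t \<bullet> x t) + \<eta>\<^sup>2 \<le> exp ((3 * L) * t) * (x0 \<bullet> x0 + \<eta>\<^sup>2)"
  proof (rule caratheodory_scalar_gronwall[OF t(1) caratheodory_add[OF caratheodory_inner[OF xt xt] c]])
    show "AE s in lebesgue_on {0..t}. (x s \<bullet> g s + g s \<bullet> x s) + 0 \<le> (3 * L) * (x s \<bullet> x s + \<eta>\<^sup>2)"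
      using le'
    proof eventually_elim
      case (elim s)
      have "x s \<bullet> g s + g s \<bullet> x s \<le> 2 * (norm (x s) * norm (g s))"
        using norm_cauchy_schwarz[of "x s" "g s"] by (simp add: inner_commute)
      also have "\<dots> \<le> 2 * (norm (x s) * (L * (norm (x s) + \<eta>)))"
        using elim by (simp add: mult_left_mono)
      also have "\<dots> = L * (2 * (norm (x s))\<^sup>2 + 2 * norm (x s) * \<eta>)"
        by (simp add: algebra_simps power2_eq_square)
      also have "\<dots> \<le> L * (2 * (norm (x s))\<^sup>2 + ((norm (x s))\<^sup>2 + \<eta>\<^sup>2))"
        using L sum_squares_bound[of "norm (x s)" \<eta>] by (intro mult_left_mono add_left_mono) auto
      also have "\<dots> \<le> L * (3 * ((norm (x s))\<^sup>2 + \<eta>\<^sup>2))"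
        using L by (intro mult_left_mono) auto
      also have "\<dots> = 3 * L * (x s \<bullet> x s + \<eta>\<^sup>2)"
        by (simp add: power2_norm_eq_inner algebra_simps)
      finally show ?case by simp
    qed
  qed
  also have "\<dots> \<le> exp (3 * L * T) * (x0 \<bullet> x0 + \<eta>\<^sup>2)"
    using t L by (intro mult_right_mono) (auto intro: mult_left_mono)
  finally show ?thesis by (simp add: power2_norm_eq_inner)
qed

subsection \<open>Existence of Caratheodory solutions\<close>

text \<open>A bounded integrand makes the indefinite integral \<open>B\<close>-Lipschitz, hence
  absolutely continuous; the equation itself is the differentiation theorem.\<close>

lemma caratheodory_integral:
  fixes g :: "real \<Rightarrow> 'a::euclidean_space"
  assumes T: "0 \<le> T" and meas: "g \<in> borel_measurable (lebesgue_on {0..T})"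
    and B: "\<And>s. s \<in> {0..T} \<Longrightarrow> norm (g s) \<le> B"
  shows "g integrable_on {0..T}"
    and "caratheodory T g x0 (\<lambda>t. x0 + integral {0..t} g)"
proof -
  show int: "g integrable_on {0..T}"
    by (rule measurable_bounded_by_integrable_imp_integrable[OF meas, where g = "\<lambda>_. B"]) (use B in auto)
  have "B \<ge> 0" using order_trans[OF norm_ge_zero B[of 0]] T by simp
  have "B-lipschitz_on {0..T} (\<lambda>t. x0 + integral {0..t} g)"
  proof (rule lipschitz_onI[OF _ \<open>B \<ge> 0\<close>], goal_cases)
    case (1 x y)
    have *: "norm (integral {0..y} g - integral {0..x} g) \<le> B * (y - x)" if "x \<in> {0..T}" "y \<in> {0..T}" "x \<le> y" for x y
    proof -
      have i: "g integrable_on {0..y}" "g integrable_on {x..y}"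
        using int that by (auto intro: integrable_on_subinterval)
      have "integral {0..y} g - integral {0..x} g = integral {x..y} g"
        using Henstock_Kurzweil_Integration.integral_combine[of 0 x y g] that i by (simp add: algebra_simps)
      also have "norm \<dots> \<le> B * measure lborel {x..y}"
        using i(2) B that by (intro has_integral_bound_real[OF \<open>B \<ge> 0\<close> finite.emptyI integrable_integral]) auto
      finally show ?thesis using that by simp
    qed
    show ?case
      using *[of x y] *[of y x] 1
      by (cases "x \<le> y") (auto simp: dist_norm norm_minus_commute)
  qed
  then have ac: "abs_cont_on 0 T (\<lambda>t. x0 + integral {0..t} g)" by (rule abs_cont_on_lipschitz)
  have "AE s in lebesgue_on {0..T}. ((\<lambda>t. integral {0..t} g) has_vector_derivative g s) (at s within {0..T})"
    using integral_has_vector_derivative_ae[OF int] by (subst AE_lebesgue_on_iff_negligible) auto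
  then have "AE s in lebesgue_on {0..T}. ((\<lambda>t. x0 + integral {0..t} g) has_vector_derivative g s) (at s within {0..T})"
    by eventually_elim (auto intro!: derivative_eq_intros)
  with ac show "caratheodory T g x0 (\<lambda>t. x0 + integral {0..t} g)"
    by (simp add: caratheodory_def)
qed

text \<open>With weight \<open>exp (- \<Lambda> * t)\<close> the Picard map contracts by
  \<open>L / \<Lambda>\<close> on the whole interval, whatever \<open>T\<close> is, so no gluing of
  short-time solutions occurs. The weight is moved into the unknown: the iteration runs on
  \<open>y t = exp (- \<Lambda> * t) *\<^sub>R x t\<close> in the space of bounded continuous
  functions with its ordinary supremum norm.\<close>

lemma caratheodory_exists_global_lipschitz:
  fixes f :: "real \<Rightarrow> 'a::euclidean_space \<Rightarrow> 'a"
  assumes T: "0 \<le> T" and L: "0 \<le> L"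
    and meas: "\<And>x. continuous_on {0..T} x \<Longrightarrow> (\<lambda>s. f s (x s)) \<in> borel_measurable (lebesgue_on {0..T})"
    and B: "\<And>s x. s \<in> {0..T} \<Longrightarrow> norm (f s x) \<le> B"
    and lip: "\<And>s x y. s \<in> {0..T} \<Longrightarrow> norm (f s x - f s y) \<le> L * norm (x - y)"
  shows "\<exists>x. caratheodory T (\<lambda>s. f s (x s)) x0 x"
proof -
  define \<Lambda> where "\<Lambda> = L + 1"
  have \<Lambda>: "\<Lambda> > 0" "L / \<Lambda> < 1" "0 \<le> L / \<Lambda>" using L by (auto simp: \<Lambda>_def)
  \<comment> \<open>The exponential undoes the weight: the field is evaluated at the unweighted
    curve.\<close>
  define h where "h y s = f s (exp (\<Lambda> * s) *\<^sub>R apply_bcontfun y s)" for y :: "real \<Rightarrow>\<^sub>C 'a" and s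
  define I where "I y t = x0 + integral {0..t} (h y)" for y t
  define P where "P y t = exp (- \<Lambda> * t) *\<^sub>R I y t" for y t
  \<comment> \<open>Elements of the function space live on the whole line; clamping time to
    \<open>{0..T}\<close> extends the Picard image continuously and keeps it bounded.\<close>
  define cl where "cl t = max 0 (min T t)" for t :: real
  have cl: "cl t \<in> {0..T}" "t \<in> {0..T} \<Longrightarrow> cl t = t" for t
    using T by (auto simp: cl_def)
  have h_meas: "h y \<in> borel_measurable (lebesgue_on {0..T})" for y
    unfolding h_def
    by (rule meas) (auto intro!: continuous_intros)
  have h_bd: "norm (h y s) \<le> B" if "s \<in> {0..T}" for y s
    unfolding h_def using that by (rule B)
  note h_int = caratheodory_integral(1)[OF T h_meas h_bd]
  have car: "caratheodory T (h y) x0 (I y)" for y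
    unfolding I_def by (rule caratheodory_integral(2)[OF T h_meas h_bd])
  have P_cont: "continuous_on {0..T} (P y)" for y
    using abs_cont_on_imp_continuous_on[of 0 T "I y"] car[of y]
    unfolding P_def by (auto simp: caratheodory_def intro!: continuous_intros)
  have P_bcont: "(\<lambda>t. P y (cl t)) \<in> bcontfun" for y
    unfolding bcontfun_def
  proof (intro CollectI conjI)
    have "continuous_on UNIV cl" unfolding cl_def by (intro continuous_intros)
    then show "continuous_on UNIV (\<lambda>t. P y (cl t))"
      by (rule continuous_on_compose2[OF P_cont]) (use cl in auto)
    have "bounded (P y ` {0..T})" by (intro compact_imp_bounded compact_continuous_image P_cont) simp
    then show "bounded (range (\<lambda>t. P y (cl t)))" by (rule bounded_subset) (use cl in auto)
  qed
  define Q where "Q y = Bcontfun (\<lambda>t. P y (cl t))" for y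
  have Q: "apply_bcontfun (Q y) t = P y (cl t)" for y t
    by (simp add: Q_def Bcontfun_inverse[OF P_bcont])
  have contr: "dist (Q y) (Q z) \<le> (L / \<Lambda>) * dist y z" for y z
  proof (rule dist_bound)
    fix t
    define \<tau> where "\<tau> = cl t"
    have \<tau>: "0 \<le> \<tau>" "\<tau> \<le> T" using cl[of t] by (auto simp: \<tau>_def)
    \<comment> \<open>Integrating the exponential produces the division by \<open>\<Lambda>\<close>
      from which the contraction factor stems; the contribution of the lower limit is non-negative
      and is dropped afterwards.\<close>
    have ie: "((\<lambda>s. L * dist y z * exp (\<Lambda> * s)) has_integral
        (L * dist y z * exp (\<Lambda> * \<tau>) / \<Lambda> - L * dist y z * exp (\<Lambda> * 0) / \<Lambda>)) {0..\<tau>}"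
      using \<Lambda>(1) \<tau>
      by (intro fundamental_theorem_of_calculus)
        (auto intro!: derivative_eq_intros simp: has_real_derivative_iff_has_vector_derivative[symmetric])
    have hi: "h y integrable_on {0..\<tau>}" for y
      by (rule integrable_on_subinterval[OF h_int]) (use \<tau> in auto)
    have "norm (I y \<tau> - I z \<tau>) = norm (integral {0..\<tau>} (\<lambda>s. h y s - h z s))"
      by (simp add: I_def Henstock_Kurzweil_Integration.integral_diff[OF hi hi])
    also have "\<dots> \<le> integral {0..\<tau>} (\<lambda>s. L * dist y z * exp (\<Lambda> * s))"
    proof (rule integral_norm_bound_integral)
      show "(\<lambda>s. h y s - h z s) integrable_on {0..\<tau>}" by (rule integrable_diff[OF hi hi])
      show "(\<lambda>s. L * dist y z * exp (\<Lambda> * s)) integrable_on {0..\<tau>}"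
        using ie by (rule has_integral_integrable)
      fix s assume "s \<in> {0..\<tau>}"
      then have s: "s \<in> {0..T}" using \<tau> by auto
      have "norm (h y s - h z s) \<le> L * norm (exp (\<Lambda> * s) *\<^sub>R apply_bcontfun y s - exp (\<Lambda> * s) *\<^sub>R apply_bcontfun z s)"
        unfolding h_def by (rule lip[OF s])
      also have "\<dots> = L * (exp (\<Lambda> * s) * dist (apply_bcontfun y s) (apply_bcontfun z s))"
        by (simp add: scaleR_diff_right[symmetric] dist_norm)
      also have "\<dots> \<le> L * (exp (\<Lambda> * s) * dist y z)"
        using L by (intro mult_left_mono dist_bounded) auto
      finally show "norm (h y s - h z s) \<le> L * dist y z * exp (\<Lambda> * s)" by (simp add: mult_ac)
    qed
    also have "\<dots> = L * dist y z * exp (\<Lambda> * \<tau>) / \<Lambda> - L * dist y z * exp (\<Lambda> * 0) / \<Lambda>"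
      using ie by (rule integral_unique)
    also have "\<dots> \<le> L * dist y z * exp (\<Lambda> * \<tau>) / \<Lambda>"
      using L \<Lambda> by simp
    finally have "exp (- \<Lambda> * \<tau>) * norm (I y \<tau> - I z \<tau>) \<le> exp (- \<Lambda> * \<tau>) * (L * dist y z * exp (\<Lambda> * \<tau>) / \<Lambda>)"
      by (rule mult_left_mono) simp
    also have "\<dots> = (L / \<Lambda>) * dist y z" by (simp add: exp_minus)
    finally show "dist (apply_bcontfun (Q y) t) (apply_bcontfun (Q z) t) \<le> (L / \<Lambda>) * dist y z"
      by (simp add: Q P_def \<tau>_def dist_norm scaleR_diff_right[symmetric])
  qed
  obtain y where y: "Q y = y"
    using banach_fix_type[of "L / \<Lambda>" Q] \<Lambda> contr by auto
  have I_eq: "exp (\<Lambda> * s) *\<^sub>R apply_bcontfun y s = I y s" if "s \<in> {0..T}" for s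
  proof -
    have "apply_bcontfun y s = P y s" using Q[of y s] y cl(2)[OF that] by simp
    then show ?thesis by (simp add: P_def exp_minus)
  qed
  have "caratheodory T (\<lambda>s. f s (I y s)) x0 (I y)"
  proof (rule caratheodory_cong_AE[OF car])
    show "AE s in lebesgue_on {0..T}. h y s = f s (I y s)"
      by (rule AE_I2) (simp add: h_def I_eq)
  qed
  then show ?thesis by blast
qed

text \<open>The field is truncated by composing it with the projection onto a ball, which makes it
  bounded and globally Lipschitz. The projection does not increase norms, so the truncated field
  obeys the same growth bound; Gronwall then keeps its solution inside the ball, where the
  truncation is the identity.\<close>

theorem caratheodory_exists:
  fixes f :: "real \<Rightarrow> 'a::euclidean_space \<Rightarrow> 'a"
  assumes T: "0 \<le> T"
    and meas: "\<And>x. continuous_on {0..T} x \<Longrightarrow> (\<lambda>s. f s (x s)) \<in> borel_measurable (lebesgue_on {0..T})"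
    and growth: "\<And>s x. s \<in> {0..T} \<Longrightarrow> norm (f s x) \<le> C * (norm x + 1)"
    and lip: "\<And>R. \<exists>L. \<forall>s\<in>{0..T}. \<forall>x\<in>cball 0 R. \<forall>y\<in>cball 0 R. norm (f s x - f s y) \<le> L * norm (x - y)"
  shows "\<exists>x. caratheodory T (\<lambda>s. f s (x s)) x0 x"
proof -
  have C: "0 \<le> C" using order_trans[OF norm_ge_zero growth[of 0 0]] T by simp
  \<comment> \<open>The a priori bound of \<open>caratheodory_gronwall\<close> with rate
    \<open>C\<close> and \<open>\<eta> = 1\<close>, fixed before any solution is known.\<close>
  define R where "R = sqrt (exp (3 * C * T) * ((norm x0)\<^sup>2 + 1))"
  have R: "0 \<le> R" by (simp add: R_def)
  obtain L where L: "\<forall>s\<in>{0..T}. \<forall>x\<in>cball 0 R. \<forall>y\<in>cball 0 R. norm (f s x - f s y) \<le> L * norm (x - y)"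
    using lip by blast
  define cp where "cp = closest_point (cball (0::'a) R)"
  have ne: "cball (0::'a) R \<noteq> {}" using R by auto
  have cp_in: "cp x \<in> cball 0 R" for x
    unfolding cp_def using ne by (intro closest_point_in_set) auto
  have cp_lip: "norm (cp x - cp y) \<le> norm (x - y)" for x y
    using closest_point_lipschitz[of "cball (0::'a) R" x y] ne by (simp add: cp_def dist_norm)
  have cp_id: "cp x = x" if "norm x \<le> R" for x
    using that by (simp add: cp_def closest_point_self)
  have cp_norm: "norm (cp x) \<le> norm x" for x
    using cp_lip[of x 0] cp_id[of 0] R by simp
  have cp_cont: "continuous_on S cp" for S
    unfolding cp_def using ne by (intro continuous_on_closest_point) auto
  have "\<exists>x. caratheodory T (\<lambda>s. f s (cp (x s))) x0 x"
  proof (rule caratheodory_exists_global_lipschitz[OF T abs_ge_zero])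
    show "(\<lambda>s. f s (cp (x s))) \<in> borel_measurable (lebesgue_on {0..T})" if "continuous_on {0..T} x" for x
      using that by (intro meas continuous_on_compose2[OF cp_cont[of UNIV]]) auto
    show "norm (f s (cp x)) \<le> C * (R + 1)" if "s \<in> {0..T}" for s x
      using growth[OF that, of "cp x"] mult_left_mono[of "norm (cp x) + 1" "R + 1" C] C cp_in[of x] by simp
    show "norm (f s (cp x) - f s (cp y)) \<le> \<bar>L\<bar> * norm (x - y)" if "s \<in> {0..T}" for s x y
    proof -
      have "norm (f s (cp x) - f s (cp y)) \<le> L * norm (cp x - cp y)"
        using L that cp_in by blast
      also have "\<dots> \<le> \<bar>L\<bar> * norm (x - y)"
        using cp_lip by (intro mult_mono) auto
      finally show ?thesis .
    qed
  qed
  then obtain x where x: "caratheodory T (\<lambda>s. f s (cp (x s))) x0 x" by blast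
  have bd: "norm (x t) \<le> R" if "t \<in> {0..T}" for t
  proof -
    have "AE s in lebesgue_on {0..T}. norm (f s (cp (x s))) \<le> C * (norm (x s) + 1)"
    proof (rule AE_I2)
      fix s assume "s \<in> space (lebesgue_on {0..T})"
      then have "norm (f s (cp (x s))) \<le> C * (norm (cp (x s)) + 1)" by (intro growth) simp
      also have "\<dots> \<le> C * (norm (x s) + 1)" using C cp_norm by (intro mult_left_mono) auto
      finally show "norm (f s (cp (x s))) \<le> C * (norm (x s) + 1)" .
    qed
    from caratheodory_gronwall[OF x C _ _ this, of t] that
    have "(norm (x t))\<^sup>2 \<le> exp (3 * C * T) * ((norm x0)\<^sup>2 + 1)" by simp
    then show ?thesis unfolding R_def by (rule real_le_rsqrt)
  qed
  have "caratheodory T (\<lambda>s. f s (x s)) x0 x"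
    by (rule caratheodory_cong_AE[OF x], rule AE_I2) (simp add: bd cp_id)
  then show ?thesis by blast
qed

subsection \<open>Vector fields depending on a control\<close>

text \<open>The norm on matrices is the Euclidean norm of the vector of row norms, so this is
  Cauchy-Schwarz row by row.\<close>

lemma norm_matrix_vector_mult_le: "norm (A *v x) \<le> norm A * norm x" for A :: "real^'n^'m"
proof -
  have "norm (A *v x) \<le> norm (\<chi> i. norm (A $ i) * norm x)"
  proof (rule norm_le_componentwise_cart)
    fix i
    show "norm ((A *v x) $ i) \<le> norm ((\<chi> i. norm (A $ i) * norm x) $ i)"
      using Cauchy_Schwarz_ineq2[of "A $ i" x] by (simp add: matrix_vector_mul_component abs_mult)
  qed
  also have "(\<chi> i. norm (A $ i) * norm x) = norm x *\<^sub>R (\<chi> i. norm (A $ i))"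
    by (simp add: vec_eq_iff mult.commute)
  also have "norm \<dots> = norm x * norm (\<chi> i. norm (A $ i))" by simp
  also have "norm (\<chi> i. norm (A $ i)) = norm A" by (simp add: norm_vec_def)
  finally show ?thesis by (simp add: mult.commute)
qed

lemma bounded_bilinear_matrix_vector_mult:
  "bounded_bilinear (\<lambda>(A :: real^'n^'m) x. A *v x)"
proof
  show "\<exists>K. \<forall>A x. norm ((A :: real^'n^'m) *v x) \<le> norm A * norm x * K"
    by (rule exI[of _ 1]) (simp add: norm_matrix_vector_mult_le)
qed (simp_all add: matrix_vector_mult_add_rdistrib matrix_vector_right_distrib
    scaleR_matrix_vector_assoc[symmetric] matrix_vector_mult_scaleR)

text \<open>\<open>local_lipschitz\<close> carries a dummy time parameter, which is shrunk to the
  compact set \<open>{0}\<close> so that compactness of \<open>X\<close> yields a single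
  constant.\<close>

lemma loc_lipschitz_lipschitz_on:
  assumes "loc_lipschitz f" "compact X"
  obtains L where "L-lipschitz_on X f"
proof -
  have "local_lipschitz (UNIV::real set) X (\<lambda>_. f)"
    using assms(1) local_lipschitz_subset[of UNIV UNIV] by (auto simp: loc_lipschitz_def)
  then have "local_lipschitz {0::real} X (\<lambda>_. f)"
    by (rule local_lipschitz_subset) auto
  then show ?thesis
    using local_lipschitz_compact_implies_lipschitz[of "{0::real}" X "\<lambda>_. f"] assms(2) that by auto
qed

lemma loc_lipschitz_imp_continuous_on: "loc_lipschitz f \<Longrightarrow> continuous_on UNIV f"
  unfolding loc_lipschitz_def by (erule local_lipschitz_continuous_on) (rule UNIV_I)

text \<open>The constants \<open>C\<close> and \<open>L\<close> are chosen before the control value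
  \<open>c\<close>; this is the source of every bound that is common to all admissible controls.
  Joint continuity serves measurability of the right-hand side along a measurable control.\<close>

definition regular_field :: "'c::euclidean_space set \<Rightarrow> ('c \<Rightarrow> 'a::euclidean_space \<Rightarrow> 'b::euclidean_space) \<Rightarrow> bool" where
  "regular_field \<Omega> f \<longleftrightarrow>
     continuous_on UNIV (\<lambda>p. f (fst p) (snd p)) \<and>
     (\<exists>C. \<forall>c\<in>\<Omega>. \<forall>x. norm (f c x) \<le> C * (norm x + 1)) \<and>
     (\<forall>R. \<exists>L. \<forall>c\<in>\<Omega>. L-lipschitz_on (cball 0 R) (f c))"

lemma regular_field_growth:
  assumes "regular_field \<Omega> f"
  obtains C where "0 \<le> C" "\<And>c x. c \<in> \<Omega> \<Longrightarrow> norm (f c x) \<le> C * (norm x + 1)"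
proof -
  obtain C where C: "\<forall>c\<in>\<Omega>. \<forall>x. norm (f c x) \<le> C * (norm x + 1)"
    using assms unfolding regular_field_def by auto
  have "norm (f c x) \<le> \<bar>C\<bar> * (norm x + 1)" if "c \<in> \<Omega>" for c x
    using C that mult_right_mono[OF abs_ge_self[of C], of "norm x + 1"] by (meson order_trans norm_ge_zero add_nonneg_nonneg zero_le_one)
  then show ?thesis using that[of "\<bar>C\<bar>"] by simp
qed

lemma regular_field_lipschitz:
  assumes "regular_field \<Omega> f"
  obtains L where "\<forall>c\<in>\<Omega>. L-lipschitz_on (cball 0 R) (f c)"
  using assms unfolding regular_field_def by meson

lemma regular_field_autonomous:
  assumes F: "loc_lipschitz F" "linear_growth F"
  shows "regular_field \<Omega> (\<lambda>c. F)"
proof -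
  obtain C where "\<forall>x. norm (F x) \<le> C * (1 + norm x)" using F(2) by (auto simp: linear_growth_def)
  then have "\<exists>C. \<forall>c\<in>\<Omega>. \<forall>x. norm (F x) \<le> C * (norm x + 1)" by (auto simp: add.commute)
  moreover have "continuous_on UNIV (\<lambda>p. F (snd p))"
    by (rule continuous_on_compose2[OF loc_lipschitz_imp_continuous_on[OF F(1)]]) (auto intro: continuous_intros)
  moreover have "\<exists>L. \<forall>c\<in>\<Omega>. L-lipschitz_on (cball 0 R) F" for R
    using loc_lipschitz_lipschitz_on[OF F(1) compact_cball, of 0 R] by metis
  ultimately show ?thesis by (simp add: regular_field_def)
qed

text \<open>\<open>P\<close> selects the component of a control pair on which the matrix acts. A
  bound for its image makes the growth and Lipschitz constants of \<open>H\<close> uniform over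
  control values.\<close>

lemma regular_field_matrix:
  fixes H :: "'a::euclidean_space \<Rightarrow> real^'p^'m"
  assumes H: "loc_lipschitz H" "linear_growth H" and P: "bounded_linear P" and \<Omega>: "bounded (P ` \<Omega>)"
  shows "regular_field \<Omega> (\<lambda>c x. H x *v P c)"
proof -
  interpret bb: bounded_bilinear "\<lambda>(A :: real^'p^'m) x. A *v x"
    by (rule bounded_bilinear_matrix_vector_mult)
  obtain B where B: "B > 0" "\<And>c. c \<in> \<Omega> \<Longrightarrow> norm (P c) \<le> B"
    using \<Omega> unfolding bounded_pos by auto
  obtain C where C: "\<And>x. norm (H x) \<le> C * (1 + norm x)" using H(2) by (auto simp: linear_growth_def)
  have "norm (H x *v P c) \<le> (C * B) * (norm x + 1)" if "c \<in> \<Omega>" for c x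
  proof -
    have "norm (H x *v P c) \<le> norm (H x) * norm (P c)" by (rule norm_matrix_vector_mult_le)
    also have "\<dots> \<le> (C * (1 + norm x)) * B"
      using C B that order_trans[OF norm_ge_zero C] by (intro mult_mono) auto
    finally show ?thesis by (simp add: algebra_simps)
  qed
  then have 1: "\<exists>C. \<forall>c\<in>\<Omega>. \<forall>x. norm (H x *v P c) \<le> C * (norm x + 1)" by blast
  have "continuous_on UNIV (\<lambda>p. H (snd p))"
    by (rule continuous_on_compose2[OF loc_lipschitz_imp_continuous_on[OF H(1)]]) (auto intro: continuous_intros)
  then have 2: "continuous_on UNIV (\<lambda>p. H (snd p) *v P (fst p))"
    by (intro bb.continuous_on bounded_linear.continuous_on[OF P] continuous_intros)
  have 3: "\<exists>L. \<forall>c\<in>\<Omega>. L-lipschitz_on (cball 0 R) (\<lambda>x. H x *v P c)" for R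
  proof -
    obtain L where L: "L-lipschitz_on (cball 0 R) H"
      using loc_lipschitz_lipschitz_on[OF H(1) compact_cball] by metis
    have "(L * B)-lipschitz_on (cball 0 R) (\<lambda>x. H x *v P c)" if "c \<in> \<Omega>" for c
    proof (rule lipschitz_onI)
      fix x y :: 'a assume xy: "x \<in> cball 0 R" "y \<in> cball 0 R"
      have "norm (H x *v P c - H y *v P c) \<le> norm (H x - H y) * norm (P c)"
        by (simp add: bb.diff_left[symmetric] norm_matrix_vector_mult_le)
      also have "\<dots> \<le> (L * norm (x - y)) * B"
        using lipschitz_on_normD[OF L xy] B that lipschitz_on_nonneg[OF L] by (intro mult_mono) auto
      finally show "dist (H x *v P c) (H y *v P c) \<le> L * B * dist x y"
        by (simp add: dist_norm mult_ac)
    qed (use B lipschitz_on_nonneg[OF L] in simp)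
    then show ?thesis by blast
  qed
  show ?thesis using 1 2 3 by (simp add: regular_field_def)
qed

lemma regular_field_compose_linear:
  assumes A: "bounded_linear A" and f: "regular_field \<Omega> f"
  shows "regular_field \<Omega> (\<lambda>c x. A (f c x))"
proof -
  obtain K where K: "K > 0" "\<And>x. norm (A x) \<le> norm x * K"
    using bounded_linear.pos_bounded[OF A] by auto
  obtain C where C: "0 \<le> C" "\<And>c x. c \<in> \<Omega> \<Longrightarrow> norm (f c x) \<le> C * (norm x + 1)"
    by (rule regular_field_growth[OF f]) blast
  have "norm (A (f c x)) \<le> (C * K) * (norm x + 1)" if "c \<in> \<Omega>" for c x
    using K(2)[of "f c x"] mult_right_mono[OF C(2)[OF that, of x], of K] K(1) by (simp add: algebra_simps)
  then have "\<exists>C. \<forall>c\<in>\<Omega>. \<forall>x. norm (A (f c x)) \<le> C * (norm x + 1)" by blast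
  moreover have "continuous_on UNIV (\<lambda>p. A (f (fst p) (snd p)))"
    using f by (intro bounded_linear.continuous_on[OF A]) (simp add: regular_field_def)
  moreover have "\<exists>L. \<forall>c\<in>\<Omega>. L-lipschitz_on (cball 0 R) (\<lambda>x. A (f c x))" for R
  proof -
    obtain L where L: "\<forall>c\<in>\<Omega>. L-lipschitz_on (cball 0 R) (f c)"
      by (rule regular_field_lipschitz[OF f])
    have "K-lipschitz_on X A" for X
      using K A by (intro lipschitz_onI) (simp_all add: dist_norm bounded_linear.linear linear_diff[symmetric] mult.commute)
    then show ?thesis
      using L by (intro exI[of _ "K * L"] ballI lipschitz_on_compose2[of L _ _ K A]) auto
  qed
  ultimately show ?thesis by (simp add: regular_field_def)
qed

lemma regular_field_linear_compose:
  assumes A: "bounded_linear A" and f: "regular_field \<Omega> f"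
  shows "regular_field \<Omega> (\<lambda>c x. f c (A x))"
proof -
  obtain K where K: "K > 0" "\<And>x. norm (A x) \<le> norm x * K"
    using bounded_linear.pos_bounded[OF A] by auto
  obtain C where C: "0 \<le> C" "\<And>c x. c \<in> \<Omega> \<Longrightarrow> norm (f c x) \<le> C * (norm x + 1)"
    by (rule regular_field_growth[OF f]) blast
  have "norm (f c (A x)) \<le> (C * (K + 1)) * (norm x + 1)" if "c \<in> \<Omega>" for c x
  proof -
    have "norm (f c (A x)) \<le> C * (norm (A x) + 1)" using C that by blast
    also have "\<dots> \<le> C * ((K + 1) * (norm x + 1))"
      using K(1) K(2)[of x] C(1) by (intro mult_left_mono) (simp_all add: algebra_simps add_increasing add_increasing2)
    finally show ?thesis by (simp add: mult_ac)
  qed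
  then have "\<exists>C. \<forall>c\<in>\<Omega>. \<forall>x. norm (f c (A x)) \<le> C * (norm x + 1)" by blast
  moreover have "continuous_on UNIV (\<lambda>p. f (fst p) (A (snd p)))"
  proof -
    have "continuous_on UNIV (\<lambda>p. (fst p, A (snd p)))"
      by (intro continuous_intros bounded_linear.continuous_on[OF A])
    moreover have "continuous_on UNIV (\<lambda>p. f (fst p) (snd p))" using f by (simp add: regular_field_def)
    ultimately show ?thesis
      using continuous_on_compose2[of UNIV "\<lambda>p. f (fst p) (snd p)" UNIV "\<lambda>p. (fst p, A (snd p))"] by simp
  qed
  moreover have "\<exists>L. \<forall>c\<in>\<Omega>. L-lipschitz_on (cball 0 R) (\<lambda>x. f c (A x))" for R
  proof -
    obtain L where L: "\<forall>c\<in>\<Omega>. L-lipschitz_on (cball 0 (K * \<bar>R\<bar>)) (f c)"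
      by (rule regular_field_lipschitz[OF f])
    have KA: "K-lipschitz_on (cball 0 R) A"
      using K A by (intro lipschitz_onI) (simp_all add: dist_norm bounded_linear.linear linear_diff[symmetric] mult.commute)
    have "A ` cball 0 R \<subseteq> cball 0 (K * \<bar>R\<bar>)"
    proof clarsimp
      fix x :: 'a assume "norm x \<le> R"
      then have "norm x * K \<le> \<bar>R\<bar> * K" using K(1) by (intro mult_right_mono) auto
      then show "norm (A x) \<le> K * \<bar>R\<bar>" using K(2)[of x] by (simp add: mult.commute)
    qed
    then have "\<forall>c\<in>\<Omega>. (L * K)-lipschitz_on (cball 0 R) (\<lambda>x. f c (A x))"
      using L by (intro ballI lipschitz_on_compose2[OF KA]) (auto intro: lipschitz_on_subset)
    then show ?thesis by blast
  qed
  ultimately show ?thesis by (simp add: regular_field_def)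
qed

lemma regular_field_linear:
  assumes "bounded_linear A"
  shows "regular_field \<Omega> (\<lambda>c. A)"
proof (rule regular_field_compose_linear[OF assms])
  show "regular_field \<Omega> (\<lambda>c x. x)"
    unfolding regular_field_def
    by (intro conjI allI exI[of _ 1] ballI lipschitz_on_id continuous_intros) simp
qed

text \<open>Sums and differences are pairs followed by a linear map, and the perturbed system is a
  nested pair, so constants of two fields are combined here alone.\<close>

lemma regular_field_Pair:
  assumes f: "regular_field \<Omega> f" and g: "regular_field \<Omega> g"
  shows "regular_field \<Omega> (\<lambda>c x. (f c x, g c x))"
proof -
  obtain C1 where C1: "0 \<le> C1" "\<And>c x. c \<in> \<Omega> \<Longrightarrow> norm (f c x) \<le> C1 * (norm x + 1)"
    by (rule regular_field_growth[OF f]) blast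
  obtain C2 where C2: "0 \<le> C2" "\<And>c x. c \<in> \<Omega> \<Longrightarrow> norm (g c x) \<le> C2 * (norm x + 1)"
    by (rule regular_field_growth[OF g]) blast
  have "norm (f c x, g c x) \<le> (C1 + C2) * (norm x + 1)" if "c \<in> \<Omega>" for c x
    using norm_Pair_le[of "f c x" "g c x"] C1(2)[OF that, of x] C2(2)[OF that, of x] by (simp add: algebra_simps)
  then have "\<exists>C. \<forall>c\<in>\<Omega>. \<forall>x. norm (f c x, g c x) \<le> C * (norm x + 1)" by blast
  moreover have "\<exists>L. \<forall>c\<in>\<Omega>. L-lipschitz_on (cball 0 R) (\<lambda>x. (f c x, g c x))" for R
  proof -
    obtain L where "\<forall>c\<in>\<Omega>. L-lipschitz_on (cball 0 R) (f c)"
      by (rule regular_field_lipschitz[OF f])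
    moreover obtain M where "\<forall>c\<in>\<Omega>. M-lipschitz_on (cball 0 R) (g c)"
      by (rule regular_field_lipschitz[OF g])
    ultimately show ?thesis using lipschitz_on_Pair by blast
  qed
  ultimately show ?thesis using f g by (auto simp: regular_field_def intro: continuous_on_Pair)
qed

lemma regular_field_add:
  "regular_field \<Omega> f \<Longrightarrow> regular_field \<Omega> g \<Longrightarrow> regular_field \<Omega> (\<lambda>c x. f c x + g c x)"
  using regular_field_compose_linear[OF _ regular_field_Pair, of "\<lambda>z. fst z + snd z" \<Omega> f g]
  by (simp add: bounded_linear_add bounded_linear_fst bounded_linear_snd)

lemma regular_field_diff:
  "regular_field \<Omega> f \<Longrightarrow> regular_field \<Omega> g \<Longrightarrow> regular_field \<Omega> (\<lambda>c x. f c x - g c x)"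
  using regular_field_compose_linear[OF _ regular_field_Pair, of "\<lambda>z. fst z - snd z" \<Omega> f g]
  by (simp add: bounded_linear_sub bounded_linear_fst bounded_linear_snd)

lemma regular_field_trajectory_exists:
  fixes f :: "'c::euclidean_space \<Rightarrow> 'a::euclidean_space \<Rightarrow> 'a"
  assumes T: "0 \<le> T" and f: "regular_field \<Omega> f"
    and c: "c \<in> borel_measurable (lebesgue_on {0..T})" "\<And>s. s \<in> {0..T} \<Longrightarrow> c s \<in> \<Omega>"
  shows "\<exists>x. caratheodory T (\<lambda>s. f (c s) (x s)) x0 x"
proof -
  obtain C where C: "0 \<le> C" "\<And>c x. c \<in> \<Omega> \<Longrightarrow> norm (f c x) \<le> C * (norm x + 1)"
    by (rule regular_field_growth[OF f]) blast
  show ?thesis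
  proof (rule caratheodory_exists[OF T])
    show "(\<lambda>s. f (c s) (x s)) \<in> borel_measurable (lebesgue_on {0..T})" if "continuous_on {0..T} x" for x
    proof (rule borel_measurable_continuous_Pair[where f = c and g = x and H = f, OF c(1)])
      show "x \<in> borel_measurable (lebesgue_on {0..T})"
        using that by (rule continuous_imp_measurable_on_sets_lebesgue) simp
      show "continuous_on UNIV (\<lambda>p. f (fst p) (snd p))"
        using f by (simp add: regular_field_def)
    qed
    show "norm (f (c s) x) \<le> C * (norm x + 1)" if "s \<in> {0..T}" for s x
      using C c that by blast
    show "\<exists>L. \<forall>s\<in>{0..T}. \<forall>x\<in>cball 0 R. \<forall>y\<in>cball 0 R. norm (f (c s) x - f (c s) y) \<le> L * norm (x - y)" for R
    proof -
      obtain L where "\<forall>c\<in>\<Omega>. L-lipschitz_on (cball 0 R) (f c)"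
        by (rule regular_field_lipschitz[OF f])
      then show ?thesis using c(2) lipschitz_on_normD by blast
    qed
  qed
qed

text \<open>The Gronwall bound depends on the field only through its growth constant, which is
  common to all control values; hence one radius for every control.\<close>

lemma regular_field_trajectory_bounded:
  fixes f :: "'c::euclidean_space \<Rightarrow> 'a::euclidean_space \<Rightarrow> 'a"
  assumes f: "regular_field \<Omega> f"
  obtains R where "\<And>c x t. \<lbrakk>\<And>s. s \<in> {0..T} \<Longrightarrow> c s \<in> \<Omega>; caratheodory T (\<lambda>s. f (c s) (x s)) x0 x; t \<in> {0..T}\<rbrakk>
    \<Longrightarrow> norm (x t) \<le> R"
proof -
  obtain C where C: "0 \<le> C" "\<And>c x. c \<in> \<Omega> \<Longrightarrow> norm (f c x) \<le> C * (norm x + 1)"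
    by (rule regular_field_growth[OF f]) blast
  show ?thesis
  proof (rule that)
    fix c x t assume c: "\<And>s. s \<in> {0..T} \<Longrightarrow> c s \<in> \<Omega>" and x: "caratheodory T (\<lambda>s. f (c s) (x s)) x0 x" and t: "t \<in> {0..T}"
    have "AE s in lebesgue_on {0..T}. norm (f (c s) (x s)) \<le> C * (norm (x s) + 1)"
      by (rule AE_I2) (use C c in auto)
    from caratheodory_gronwall[OF x C(1) _ _ this, of t] t
    have "(norm (x t))\<^sup>2 \<le> exp (3 * C * T) * ((norm x0)\<^sup>2 + 1)" by simp
    then show "norm (x t) \<le> sqrt (exp (3 * C * T) * ((norm x0)\<^sup>2 + 1))" by (rule real_le_rsqrt)
  qed
qed

subsection \<open>The singularly perturbed control problem\<close>

text \<open>The algebra behind the energy estimate: \<open>x\<close>, \<open>y\<close>,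
  \<open>z\<close> stand for the norms of \<open>u\<close>, \<open>v\<close>, \<open>w\<close> and
  \<open>d\<close> for that of \<open>D\<close>. The damping of the fast variable supplies
  \<open>- 2 * z\<^sup>2\<close>. Each of the three products containing \<open>z\<close> is split by
  completing a square so that it costs \<open>z\<^sup>2 / 2\<close>, which leaves
  \<open>- z\<^sup>2 / 2\<close>; what remains involves only \<open>x\<close> and
  \<open>y\<close>.\<close>

lemma energy_inequality:
  fixes x y z d a C1 C2 :: real
  assumes nonneg: "0 \<le> x" "0 \<le> y" "0 \<le> z" "0 \<le> d" "0 \<le> a" "0 \<le> C1" "0 \<le> C2"
  shows "2 * (x * (d * y + d * z + C2 * (x + 1))) + 2 * (a * (y * (d * x)))
      + 2 * (z * y + z * (C1 * (x + 1)) - z\<^sup>2)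
    \<le> (2 * d\<^sup>2 + 2 + 4 * C1\<^sup>2 + d * (1 + a) + 4 * C2) * (x\<^sup>2 + y\<^sup>2 + 1)"
proof -
  define S where "S = x\<^sup>2 + y\<^sup>2 + 1"
  have S: "x\<^sup>2 \<le> S" "y\<^sup>2 \<le> S" "0 \<le> S" by (auto simp: S_def)
  have S2: "2 * S = 2 * x\<^sup>2 + 2 + 2 * y\<^sup>2" by (simp add: S_def)
  have "2 * x * y \<le> S" using sum_squares_bound[of x y] by (simp add: S_def)
  then have h1: "d * (1 + a) * (2 * x * y) \<le> d * (1 + a) * S"
    using nonneg by (intro mult_left_mono) auto
  have "0 \<le> (2 * d * x - z)\<^sup>2" by simp
  then have "2 * d * x * z \<le> 2 * d\<^sup>2 * x\<^sup>2 + z\<^sup>2 / 2" by (simp add: power2_eq_square algebra_simps)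
  moreover have "2 * d\<^sup>2 * x\<^sup>2 \<le> 2 * d\<^sup>2 * S" using S by (intro mult_left_mono) auto
  ultimately have h2: "2 * d * x * z \<le> 2 * d\<^sup>2 * S + z\<^sup>2 / 2" by linarith
  have "0 \<le> (2 * y - z)\<^sup>2" by simp
  then have "2 * z * y \<le> 2 * y\<^sup>2 + z\<^sup>2 / 2" by (simp add: power2_eq_square algebra_simps)
  then have h3: "2 * z * y \<le> 2 * S + z\<^sup>2 / 2" using S by linarith
  have "0 \<le> (2 * C1 * (x + 1) - z)\<^sup>2" by simp
  then have "2 * z * C1 * (x + 1) \<le> 2 * C1\<^sup>2 * (x + 1)\<^sup>2 + z\<^sup>2 / 2"
    by (simp add: power2_eq_square algebra_simps)
  moreover have "(x + 1)\<^sup>2 \<le> 2 * x\<^sup>2 + 2"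
    using sum_squares_bound[of x 1] by (simp add: power2_eq_square algebra_simps)
  then have "(x + 1)\<^sup>2 \<le> 2 * S" using S2 zero_le_power2[of y] by linarith
  then have "2 * C1\<^sup>2 * (x + 1)\<^sup>2 \<le> 2 * C1\<^sup>2 * (2 * S)"
    by (intro mult_left_mono) auto
  ultimately have h4: "2 * z * C1 * (x + 1) \<le> 4 * C1\<^sup>2 * S + z\<^sup>2 / 2" by linarith
  have "x * (x + 1) \<le> 2 * x\<^sup>2 + 2"
    using sum_squares_bound[of x 1] nonneg by (simp add: power2_eq_square algebra_simps)
  then have "x * (x + 1) \<le> 2 * S" using S2 zero_le_power2[of y] by linarith
  then have h5: "2 * C2 * (x * (x + 1)) \<le> 2 * C2 * (2 * S)"
    using nonneg by (intro mult_left_mono) auto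
  have "2 * (x * (d * y + d * z + C2 * (x + 1))) + 2 * (a * (y * (d * x)))
      + 2 * (z * y + z * (C1 * (x + 1)) - z\<^sup>2)
    = d * (1 + a) * (2 * x * y) + 2 * d * x * z + 2 * z * y + 2 * z * C1 * (x + 1)
      + 2 * C2 * (x * (x + 1)) - 2 * z\<^sup>2"
    by (simp add: algebra_simps)
  also have "\<dots> \<le> (2 * d\<^sup>2 + 2 + 4 * C1\<^sup>2 + d * (1 + a) + 4 * C2) * S - z\<^sup>2 / 2"
    using h1 h2 h3 h4 h5 unfolding distrib_right[of _ _ S] by linarith
  also have "\<dots> \<le> (2 * d\<^sup>2 + 2 + 4 * C1\<^sup>2 + d * (1 + a) + 4 * C2) * S" by simp
  finally show ?thesis by (simp add: S_def)
qed

text \<open>\<open>\<kappa> \<epsilon>\<close> is the largest oscillation of \<open>\<Phi>\<close>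
  over pairs at distance at most \<open>\<mu> \<epsilon>\<close>. Taking a supremum, rather than
  choosing a rate near 0, gives a bound for every positive \<open>\<epsilon>\<close>, as the notion
  of approximation demands; compactness keeps it finite.\<close>

lemma uniform_modulus:
  fixes \<Phi> :: "'a::euclidean_space \<Rightarrow> real"
  assumes \<Phi>: "continuous_on UNIV \<Phi>" and \<mu>: "(\<mu> \<longlongrightarrow> 0) (at_right 0)" "\<And>\<epsilon>. \<epsilon> > 0 \<Longrightarrow> 0 \<le> \<mu> \<epsilon>" and R: "0 \<le> R"
  obtains \<kappa> where "(\<kappa> \<longlongrightarrow> 0) (at_right (0::real))"
    "\<forall>\<epsilon>>0. \<forall>x y. norm y \<le> R \<longrightarrow> norm (x - y) \<le> \<mu> \<epsilon> \<longrightarrow> \<bar>\<Phi> x - \<Phi> y\<bar> \<le> \<kappa> \<epsilon>"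
proof -
  define A where "A \<epsilon> = {(x, y :: 'a). norm y \<le> R \<and> norm (x - y) \<le> \<mu> \<epsilon>}" for \<epsilon>
  define \<kappa> where "\<kappa> \<epsilon> = (SUP (x, y)\<in>A \<epsilon>. \<bar>\<Phi> x - \<Phi> y\<bar>)" for \<epsilon>
  have bdd: "bdd_above ((\<lambda>(x, y). \<bar>\<Phi> x - \<Phi> y\<bar>) ` A \<epsilon>)" if "\<epsilon> > 0" for \<epsilon>
  proof -
    have "compact (\<Phi> ` cball 0 (R + \<mu> \<epsilon>))"
      by (rule compact_continuous_image[OF continuous_on_subset[OF \<Phi>]]) auto
    then have "bounded (\<Phi> ` cball 0 (R + \<mu> \<epsilon>))" by (rule compact_imp_bounded)
    then obtain B where B: "\<forall>x\<in>cball 0 (R + \<mu> \<epsilon>). \<bar>\<Phi> x\<bar> \<le> B"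
      unfolding bounded_iff by auto
    have "\<bar>\<Phi> x - \<Phi> y\<bar> \<le> 2 * B" if "(x, y) \<in> A \<epsilon>" for x y
    proof -
      have xy: "norm y \<le> R" "norm (x - y) \<le> \<mu> \<epsilon>" using that by (auto simp: A_def)
      moreover have "norm x \<le> norm y + norm (x - y)" using norm_triangle_sub[of x y] by simp
      ultimately have "x \<in> cball 0 (R + \<mu> \<epsilon>)" "y \<in> cball 0 (R + \<mu> \<epsilon>)"
        using \<mu>(2)[OF \<open>\<epsilon> > 0\<close>] by auto
      then show ?thesis using bspec[OF B, of x] bspec[OF B, of y] by linarith
    qed
    then show ?thesis by (intro bdd_aboveI[of _ "2 * B"]) auto
  qed
  have upper: "\<bar>\<Phi> x - \<Phi> y\<bar> \<le> \<kappa> \<epsilon>" if "\<epsilon> > 0" "norm y \<le> R" "norm (x - y) \<le> \<mu> \<epsilon>" for \<epsilon> x y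
    unfolding \<kappa>_def using that cSUP_upper[OF _ bdd[OF that(1)], of "(x, y)"] by (simp add: A_def)
  have "(\<kappa> \<longlongrightarrow> 0) (at_right 0)"
  proof (rule tendstoI)
    fix e :: real assume e: "e > 0"
    \<comment> \<open>Once \<open>\<mu> \<epsilon> < 1\<close>, both points of a pair lie in the
      ball of radius \<open>R + 1\<close>.\<close>
    have "uniformly_continuous_on (cball 0 (R + 1)) \<Phi>"
      by (rule compact_uniformly_continuous[OF continuous_on_subset[OF \<Phi>]]) auto
    then obtain d where d: "d > 0"
      "\<And>x y. \<lbrakk>x \<in> cball 0 (R + 1); y \<in> cball 0 (R + 1); dist y x < d\<rbrakk> \<Longrightarrow> dist (\<Phi> y) (\<Phi> x) < e / 2"
      unfolding uniformly_continuous_on_def using half_gt_zero[OF e] by metis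
    have "\<forall>\<^sub>F \<epsilon> in at_right 0. \<mu> \<epsilon> < min d 1"
      using \<mu>(1) d(1) by (intro order_tendstoD) auto
    moreover have "\<forall>\<^sub>F \<epsilon> in at_right (0::real). \<epsilon> > 0"
      by (rule eventually_at_right_less)
    ultimately show "\<forall>\<^sub>F \<epsilon> in at_right 0. dist (\<kappa> \<epsilon>) 0 < e"
    proof eventually_elim
      case (elim \<epsilon>)
      have ne: "(0, 0) \<in> A \<epsilon>" using R \<mu>(2)[OF elim(2)] by (simp add: A_def)
      have "\<kappa> \<epsilon> \<le> e / 2"
        unfolding \<kappa>_def
      proof (rule cSUP_least)
        show "A \<epsilon> \<noteq> {}" using ne by auto
        fix p assume "p \<in> A \<epsilon>"
        then obtain x y where p: "p = (x, y)" "norm y \<le> R" "norm (x - y) \<le> \<mu> \<epsilon>" by (auto simp: A_def)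
        have "norm x \<le> norm y + norm (x - y)" using norm_triangle_sub[of x y] by simp
        then have "dist (\<Phi> x) (\<Phi> y) < e / 2"
          using p elim by (intro d(2)) (auto simp: dist_norm)
        then show "(case p of (x, y) \<Rightarrow> \<bar>\<Phi> x - \<Phi> y\<bar>) \<le> e / 2" by (simp add: p dist_norm)
      qed
      moreover have "0 \<le> \<kappa> \<epsilon>" using upper[OF elim(2), of 0 0] R \<mu>(2)[OF elim(2)] by simp
      ultimately show ?case using e by simp
    qed
  qed
  then show ?thesis using upper that by blast
qed

text \<open>Arbitrary members are paired, not minimisers, so neither infimum has to be
  attained.\<close>

lemma cInf_abs_diff_le:
  fixes A B :: "real set"
  assumes ne: "A \<noteq> {}" "B \<noteq> {}" and bdd: "bdd_below A" "bdd_below B"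
    and AB: "\<And>x. x \<in> A \<Longrightarrow> \<exists>y\<in>B. \<bar>x - y\<bar> \<le> k" and BA: "\<And>y. y \<in> B \<Longrightarrow> \<exists>x\<in>A. \<bar>x - y\<bar> \<le> k"
  shows "\<bar>Inf A - Inf B\<bar> \<le> k"
proof -
  have "Inf B - k \<le> Inf A"
  proof (rule cInf_greatest[OF ne(1)])
    fix x assume "x \<in> A"
    then obtain y where "y \<in> B" "\<bar>x - y\<bar> \<le> k" using AB by blast
    then show "Inf B - k \<le> x" using cInf_lower[OF _ bdd(2), of y] by linarith
  qed
  moreover have "Inf A - k \<le> Inf B"
  proof (rule cInf_greatest[OF ne(2)])
    fix y assume "y \<in> B"
    then obtain x where "x \<in> A" "\<bar>x - y\<bar> \<le> k" using BA by blast
    then show "Inf A - k \<le> y" using cInf_lower[OF _ bdd(1), of x] by linarith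
  qed
  ultimately show ?thesis by linarith
qed

section \<open>The controlled systems and existence of their trajectories\<close>

locale slow_fast_control =
  fixes T a :: real
    and D :: "real^'m^'m"
    and F :: "real^'m \<Rightarrow> real^'m"
    and H :: "real^'m \<Rightarrow> real^'p^'m"
    and G :: "real^'m \<Rightarrow> real^'q^'m"
    and u0 v0 w0 :: "real^'m"
    and \<Omega>A :: "(real^'p) set"
    and \<Omega>B :: "(real^'q) set"
  assumes T: "T > 0" and a: "a > 0"
    and compact_A: "compact \<Omega>A" and compact_B: "compact \<Omega>B"
    and F: "loc_lipschitz F" "linear_growth F"
    and H: "loc_lipschitz H" "linear_growth H"
    and G: "loc_lipschitz G" "linear_growth G"
begin

definition forcing :: "(real^'p) \<times> (real^'q) \<Rightarrow> real^'m \<Rightarrow> real^'m" where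
  "forcing c u = H u *v fst c"

text \<open>The rest point of \<open>v + w\<close> in the fast equation for frozen \<open>u\<close>
  and control. The reduced field arises from the equation for \<open>u\<close> by putting it in
  place of \<open>v + w\<close>.\<close>

definition equilibrium :: "(real^'p) \<times> (real^'q) \<Rightarrow> real^'m \<Rightarrow> real^'m" where
  "equilibrium c u = F u + G u *v snd c"

abbreviation controls :: "(real \<Rightarrow> real^'p) \<Rightarrow> (real \<Rightarrow> real^'q) \<Rightarrow> bool" where
  "controls \<alpha> \<beta> \<equiv> admissible T \<Omega>A \<alpha> \<and> admissible T \<Omega>B \<beta>"

abbreviation sp :: "real \<Rightarrow> (real \<Rightarrow> real^'p) \<Rightarrow> (real \<Rightarrow> real^'q) \<Rightarrow> (real \<Rightarrow> real^'m) \<Rightarrow> (real \<Rightarrow> real^'m) \<Rightarrow> (real \<Rightarrow> real^'m) \<Rightarrow> bool" where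
  "sp \<equiv> sp_sol T a D F H G u0 v0 w0"

abbreviation red :: "(real \<Rightarrow> real^'p) \<Rightarrow> (real \<Rightarrow> real^'q) \<Rightarrow> (real \<Rightarrow> real^'m) \<Rightarrow> bool" where
  "red \<equiv> red_sol T D F H G u0"

abbreviation D_norm :: real where "D_norm \<equiv> norm D"

lemma norm_D: "norm (D *v x) \<le> D_norm * norm x"
  by (rule norm_matrix_vector_mult_le)

lemma regular_forcing: "regular_field (\<Omega>A \<times> \<Omega>B) forcing"
proof -
  have "bounded (fst ` (\<Omega>A \<times> \<Omega>B))"
    using compact_A compact_B by (intro bounded_linear_image[OF _ bounded_linear_fst] bounded_Times compact_imp_bounded)
  from regular_field_matrix[OF H bounded_linear_fst this] show ?thesis
    by (simp add: forcing_def[abs_def])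
qed

lemma regular_equilibrium: "regular_field (\<Omega>A \<times> \<Omega>B) equilibrium"
proof -
  have "bounded (snd ` (\<Omega>A \<times> \<Omega>B))"
    using compact_A compact_B by (intro bounded_linear_image[OF _ bounded_linear_snd] bounded_Times compact_imp_bounded)
  from regular_field_add[OF regular_field_autonomous[OF F] regular_field_matrix[OF G bounded_linear_snd this]]
  show ?thesis by (simp add: equilibrium_def[abs_def])
qed

lemma regular_reduced: "regular_field (\<Omega>A \<times> \<Omega>B) (\<lambda>c u. forcing c u - D *v equilibrium c u)"
  by (intro regular_field_diff regular_forcing
      regular_field_compose_linear[OF matrix_vector_mul_bounded_linear] regular_equilibrium)

text \<open>The constants hidden here depend on \<open>\<epsilon>\<close> and may blow up as it
  tends to 0. The field serves existence at fixed \<open>\<epsilon>\<close>; uniform bounds come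
  from the energy.\<close>

lemma regular_perturbed:
  "regular_field (\<Omega>A \<times> \<Omega>B) (\<lambda>c z.
     (- (D *v fst (snd z)) - D *v snd (snd z) + forcing c (fst z),
      - (a *\<^sub>R (D *v fst z)),
      - ((1 / \<epsilon>) *\<^sub>R (fst (snd z) + snd (snd z) - equilibrium c (fst z)))))"
proof (intro regular_field_Pair)
  have lin: "bounded_linear (\<lambda>z::(real^'m) \<times> (real^'m) \<times> (real^'m). - (D *v fst (snd z)) - D *v snd (snd z))"
    "bounded_linear (\<lambda>z::(real^'m) \<times> (real^'m) \<times> (real^'m). - (a *\<^sub>R (D *v fst z)))"
    "bounded_linear (\<lambda>z::(real^'m) \<times> (real^'m) \<times> (real^'m). fst (snd z) + snd (snd z))"
    "bounded_linear (\<lambda>x::real^'m. - ((1 / \<epsilon>) *\<^sub>R x))"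
    unfolding linear_conv_bounded_linear[symmetric] linear_iff
    by (simp_all add: matrix_vector_right_distrib matrix_vector_mult_scaleR algebra_simps)
  show "regular_field (\<Omega>A \<times> \<Omega>B) (\<lambda>c z::(real^'m) \<times> (real^'m) \<times> (real^'m). - (D *v fst (snd z)) - D *v snd (snd z) + forcing c (fst z))"
    by (intro regular_field_add regular_field_linear lin
        regular_field_linear_compose[OF bounded_linear_fst] regular_forcing)
  show "regular_field (\<Omega>A \<times> \<Omega>B) (\<lambda>c z::(real^'m) \<times> (real^'m) \<times> (real^'m). - (a *\<^sub>R (D *v fst z)))"
    by (intro regular_field_linear lin)
  show "regular_field (\<Omega>A \<times> \<Omega>B) (\<lambda>c z::(real^'m) \<times> (real^'m) \<times> (real^'m).
      - ((1 / \<epsilon>) *\<^sub>R (fst (snd z) + snd (snd z) - equilibrium c (fst z))))"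
    by (rule regular_field_compose_linear[OF lin(4)],
        intro regular_field_diff regular_field_linear lin
          regular_field_linear_compose[OF bounded_linear_fst] regular_equilibrium)
qed

lemma controls_measurable:
  assumes "controls \<alpha> \<beta>"
  shows "(\<lambda>s. (\<alpha> s, \<beta> s)) \<in> borel_measurable (lebesgue_on {0..T})"
    and "\<And>s. s \<in> {0..T} \<Longrightarrow> (\<alpha> s, \<beta> s) \<in> \<Omega>A \<times> \<Omega>B"
  using assms by (auto simp: admissible_def)

lemma red_iff: "red \<alpha> \<beta> u \<longleftrightarrow>
    caratheodory T (\<lambda>s. forcing (\<alpha> s, \<beta> s) (u s) - D *v equilibrium (\<alpha> s, \<beta> s) (u s)) u0 u"
  by (simp add: red_sol_def forcing_def equilibrium_def)

lemma sp_iff: "sp \<epsilon> \<alpha> \<beta> u v w \<longleftrightarrow>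
    caratheodory T (\<lambda>s. - (D *v v s) - D *v w s + forcing (\<alpha> s, \<beta> s) (u s)) u0 u \<and>
    caratheodory T (\<lambda>s. - (a *\<^sub>R (D *v u s))) v0 v \<and>
    caratheodory T (\<lambda>s. - ((1 / \<epsilon>) *\<^sub>R (v s + w s - equilibrium (\<alpha> s, \<beta> s) (u s)))) w0 w"
  by (simp add: sp_sol_def forcing_def equilibrium_def algebra_simps)

lemma red_exists:
  assumes "controls \<alpha> \<beta>"
  shows "\<exists>u. red \<alpha> \<beta> u"
  using regular_field_trajectory_exists[OF _ regular_reduced controls_measurable[OF assms], of u0] T
  by (simp add: red_iff)

lemma sp_exists:
  assumes "controls \<alpha> \<beta>"
  shows "\<exists>u v w. sp \<epsilon> \<alpha> \<beta> u v w"
proof -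
  obtain z where z: "caratheodory T (\<lambda>s.
     (- (D *v fst (snd (z s))) - D *v snd (snd (z s)) + forcing (\<alpha> s, \<beta> s) (fst (z s)),
      - (a *\<^sub>R (D *v fst (z s))),
      - ((1 / \<epsilon>) *\<^sub>R (fst (snd (z s)) + snd (snd (z s)) - equilibrium (\<alpha> s, \<beta> s) (fst (z s))))))
     (u0, v0, w0) z"
    using regular_field_trajectory_exists[OF _ regular_perturbed[of \<epsilon>] controls_measurable[OF assms], where ?x0.0 = "(u0, v0, w0)"] T
    by auto
  note z1 = caratheodory_bounded_linear[OF bounded_linear_fst z]
  note z2 = caratheodory_bounded_linear[OF bounded_linear_snd z]
  note z21 = caratheodory_bounded_linear[OF bounded_linear_fst z2]
  note z22 = caratheodory_bounded_linear[OF bounded_linear_snd z2]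
  have "sp \<epsilon> \<alpha> \<beta> (\<lambda>s. fst (z s)) (\<lambda>s. fst (snd (z s))) (\<lambda>s. snd (snd (z s)))"
    unfolding sp_iff using z1 z21 z22 by simp
  then show ?thesis by blast
qed

section \<open>Estimates uniform over the controls\<close>

lemma red_bounded:
  obtains R where "0 \<le> R" "\<And>\<alpha> \<beta> u t. \<lbrakk>controls \<alpha> \<beta>; red \<alpha> \<beta> u; t \<in> {0..T}\<rbrakk> \<Longrightarrow> norm (u t) \<le> R"
proof -
  obtain R where R: "\<And>c x t. \<lbrakk>\<And>s. s \<in> {0..T} \<Longrightarrow> c s \<in> \<Omega>A \<times> \<Omega>B;
      caratheodory T (\<lambda>s. forcing (c s) (x s) - D *v equilibrium (c s) (x s)) u0 x; t \<in> {0..T}\<rbrakk>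
    \<Longrightarrow> norm (x t) \<le> R"
    by (rule regular_field_trajectory_bounded[OF regular_reduced, of T u0]) blast
  have "norm (u t) \<le> \<bar>R\<bar>" if "controls \<alpha> \<beta>" "red \<alpha> \<beta> u" "t \<in> {0..T}" for \<alpha> \<beta> u t
  proof -
    have "norm (u t) \<le> R"
      using R[of "\<lambda>s. (\<alpha> s, \<beta> s)" u t] controls_measurable(2)[OF that(1)] that by (simp add: red_iff)
    then show ?thesis by simp
  qed
  then show ?thesis using that[of "\<bar>R\<bar>"] by simp
qed

text \<open>
  The weight \<open>\<epsilon>\<close> in front of \<open>w \<bullet> w\<close> cancels the singular factor, so the growth rate
  \<open>K\<close> does not depend on \<open>\<epsilon>\<close>.
\<close>

lemma sp_energy:
  obtains K where "0 \<le> K" "\<And>\<epsilon> \<alpha> \<beta> u v w t. \<lbrakk>\<epsilon> > 0; controls \<alpha> \<beta>; sp \<epsilon> \<alpha> \<beta> u v w; t \<in> {0..T}\<rbrakk> \<Longrightarrow>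
    (norm (u t))\<^sup>2 + \<epsilon> * (norm (w t))\<^sup>2
      \<le> exp (K * T) * ((norm u0)\<^sup>2 + (norm v0)\<^sup>2 + \<epsilon> * (norm w0)\<^sup>2 + 1)"
proof -
  obtain C1 where C1: "0 \<le> C1" "\<And>c x. c \<in> \<Omega>A \<times> \<Omega>B \<Longrightarrow> norm (equilibrium c x) \<le> C1 * (norm x + 1)"
    by (rule regular_field_growth[OF regular_equilibrium]) blast
  obtain C2 where C2: "0 \<le> C2" "\<And>c x. c \<in> \<Omega>A \<times> \<Omega>B \<Longrightarrow> norm (forcing c x) \<le> C2 * (norm x + 1)"
    by (rule regular_field_growth[OF regular_forcing]) blast
  define K where "K = 2 * D_norm\<^sup>2 + 2 + 4 * C1\<^sup>2 + D_norm * (1 + a) + 4 * C2"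
  have K: "0 \<le> K" using a C2 by (simp add: K_def)
  show ?thesis
  proof (rule that[OF K])
    fix \<epsilon> :: real and \<alpha> \<beta> u v w t
    assume \<epsilon>: "\<epsilon> > 0" and ctrl: "controls \<alpha> \<beta>" and "sp \<epsilon> \<alpha> \<beta> u v w" and t: "t \<in> {0..T}"
    define gu where "gu s = - (D *v v s) - D *v w s + forcing (\<alpha> s, \<beta> s) (u s)" for s
    define gv where "gv s = - (a *\<^sub>R (D *v u s))" for s
    define gw where "gw s = - ((1 / \<epsilon>) *\<^sub>R (v s + w s - equilibrium (\<alpha> s, \<beta> s) (u s)))" for s
    have "caratheodory T gu u0 u" "caratheodory T gv v0 v" "caratheodory T gw w0 w"
      using \<open>sp \<epsilon> \<alpha> \<beta> u v w\<close> by (simp_all add: sp_iff gu_def[abs_def] gv_def[abs_def] gw_def[abs_def])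
    with t have u: "caratheodory t gu u0 u" and v: "caratheodory t gv v0 v" and w: "caratheodory t gw w0 w"
      by (auto intro: caratheodory_subinterval)
    \<comment> \<open>The constant 1 joins the energy so that the affine part of linear growth is
      absorbed into a homogeneous inequality.\<close>
    have one: "caratheodory t (\<lambda>s. 0) 1 (\<lambda>s. 1::real)"
      using caratheodory_deriv[of t "\<lambda>s. 1::real" "\<lambda>s. 0"] by simp
    note ww = caratheodory_bounded_linear[OF bounded_linear_mult_right[of \<epsilon>] caratheodory_inner[OF w w]]
    note E = caratheodory_add[OF caratheodory_add[OF caratheodory_inner[OF u u] caratheodory_inner[OF v v]]
        caratheodory_add[OF ww one]]
    have "u t \<bullet> u t + v t \<bullet> v t + (\<epsilon> * (w t \<bullet> w t) + 1)
        \<le> exp (K * t) * (u0 \<bullet> u0 + v0 \<bullet> v0 + (\<epsilon> * (w0 \<bullet> w0) + 1))"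
    proof (rule caratheodory_scalar_gronwall[OF _ E], use t in simp, rule AE_I2)
      fix s assume "s \<in> space (lebesgue_on {0..t})"
      then have s: "(\<alpha> s, \<beta> s) \<in> \<Omega>A \<times> \<Omega>B" using t controls_measurable(2)[OF ctrl] by simp
      let ?x = "norm (u s)" and ?y = "norm (v s)" and ?z = "norm (w s)"
      let ?e = "equilibrium (\<alpha> s, \<beta> s) (u s)" and ?f = "forcing (\<alpha> s, \<beta> s) (u s)"
      have "norm (gu s) \<le> norm (D *v v s) + norm (D *v w s) + norm ?f"
        unfolding gu_def by (metis norm_triangle_le add_mono norm_triangle_ineq4 norm_minus_cancel order_refl)
      also have "\<dots> \<le> D_norm * ?y + D_norm * ?z + C2 * (?x + 1)"
        using norm_D C2(2)[OF s] by (intro add_mono)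
      finally have 1: "u s \<bullet> gu s \<le> ?x * (D_norm * ?y + D_norm * ?z + C2 * (?x + 1))"
        using norm_cauchy_schwarz[of "u s" "gu s"] by (meson mult_left_mono norm_ge_zero order_trans)
      have "v s \<bullet> gv s = a * (v s \<bullet> - (D *v u s))" by (simp add: gv_def)
      also have "\<dots> \<le> a * (?y * (D_norm * ?x))"
      proof (rule mult_left_mono)
        have "v s \<bullet> - (D *v u s) \<le> ?y * norm (D *v u s)"
          using norm_cauchy_schwarz[of "v s" "- (D *v u s)"] by simp
        also have "\<dots> \<le> ?y * (D_norm * ?x)" by (intro mult_left_mono norm_D) simp
        finally show "v s \<bullet> - (D *v u s) \<le> ?y * (D_norm * ?x)" .
      qed (use a in simp)
      finally have 2: "v s \<bullet> gv s \<le> a * (?y * (D_norm * ?x))" .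
      have "\<epsilon> * (w s \<bullet> gw s) = - (w s \<bullet> v s) + w s \<bullet> ?e - ?z\<^sup>2"
        using \<epsilon> by (simp add: gw_def inner_diff_right inner_add_right power2_norm_eq_inner)
      also have "- (w s \<bullet> v s) \<le> ?z * ?y"
        using norm_cauchy_schwarz[of "w s" "- v s"] by simp
      also have "w s \<bullet> ?e \<le> ?z * (C1 * (?x + 1))"
        using norm_cauchy_schwarz[of "w s" ?e] C1(2)[OF s, of "u s"] by (meson mult_left_mono norm_ge_zero order_trans)
      finally have 3: "\<epsilon> * (w s \<bullet> gw s) \<le> ?z * ?y + ?z * (C1 * (?x + 1)) - ?z\<^sup>2" by simp
      have "u s \<bullet> gu s + gu s \<bullet> u s + (v s \<bullet> gv s + gv s \<bullet> v s) + (\<epsilon> * (w s \<bullet> gw s + gw s \<bullet> w s) + 0)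
        = 2 * (u s \<bullet> gu s) + 2 * (v s \<bullet> gv s) + 2 * (\<epsilon> * (w s \<bullet> gw s))"
        by (simp add: inner_commute)
      also have "\<dots> \<le> 2 * (?x * (D_norm * ?y + D_norm * ?z + C2 * (?x + 1))) + 2 * (a * (?y * (D_norm * ?x)))
          + 2 * (?z * ?y + ?z * (C1 * (?x + 1)) - ?z\<^sup>2)"
        by (intro add_mono mult_left_mono 1 2 3) simp_all
      also have "\<dots> \<le> K * (?x\<^sup>2 + ?y\<^sup>2 + 1)"
        unfolding K_def using a C1(1) C2(1) by (intro energy_inequality) auto
      also have "\<dots> \<le> K * (?x\<^sup>2 + ?y\<^sup>2 + (\<epsilon> * ?z\<^sup>2 + 1))"
        using K \<epsilon> by (intro mult_left_mono) auto
      finally show "u s \<bullet> gu s + gu s \<bullet> u s + (v s \<bullet> gv s + gv s \<bullet> v s) + (\<epsilon> * (w s \<bullet> gw s + gw s \<bullet> w s) + 0)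
        \<le> K * (u s \<bullet> u s + v s \<bullet> v s + (\<epsilon> * (w s \<bullet> w s) + 1))"
        by (simp add: power2_norm_eq_inner)
    qed
    also have "\<dots> \<le> exp (K * T) * (u0 \<bullet> u0 + v0 \<bullet> v0 + (\<epsilon> * (w0 \<bullet> w0) + 1))"
      using t K \<epsilon> by (intro mult_right_mono) (auto intro: mult_left_mono)
    finally show "(norm (u t))\<^sup>2 + \<epsilon> * (norm (w t))\<^sup>2
      \<le> exp (K * T) * ((norm u0)\<^sup>2 + (norm v0)\<^sup>2 + \<epsilon> * (norm w0)\<^sup>2 + 1)"
      by (simp add: power2_norm_eq_inner add.assoc) (smt (verit) inner_ge_zero)
  qed
qed

text \<open>
  \<open>u - \<epsilon> D w\<close> solves the reduced equation up to replacing the argument of the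
  right-hand side by \<open>u\<close>, since the equation for \<open>w\<close> turns \<open>- D (v + w)\<close> into
  \<open>- D (F u + G u \<beta>) + \<epsilon> D w'\<close>.
\<close>

lemma sp_corrected:
  assumes \<epsilon>: "\<epsilon> > 0" and "sp \<epsilon> \<alpha> \<beta> u v w"
  shows "caratheodory T (\<lambda>s. forcing (\<alpha> s, \<beta> s) (u s) - D *v equilibrium (\<alpha> s, \<beta> s) (u s))
    (u0 - \<epsilon> *\<^sub>R (D *v w0)) (\<lambda>s. u s - \<epsilon> *\<^sub>R (D *v w s))"
proof -
  have u: "caratheodory T (\<lambda>s. - (D *v v s) - D *v w s + forcing (\<alpha> s, \<beta> s) (u s)) u0 u"
    and w: "caratheodory T (\<lambda>s. - ((1 / \<epsilon>) *\<^sub>R (v s + w s - equilibrium (\<alpha> s, \<beta> s) (u s)))) w0 w"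
    using assms(2) by (simp_all add: sp_iff)
  have lin: "bounded_linear (\<lambda>x. \<epsilon> *\<^sub>R (D *v x))"
    by (rule bounded_linear_compose[OF bounded_linear_scaleR_right matrix_vector_mul_bounded_linear])
  have neg: "D *v (- x) = - (D *v x)" for x
    using matrix_vector_mult_scaleR[of D "-1" x] by simp
  have eq: "- (D *v v s) - D *v w s + f
      - \<epsilon> *\<^sub>R (D *v - ((1 / \<epsilon>) *\<^sub>R (v s + w s - e))) = f - D *v e" for s f e
    using \<epsilon> by (simp add: neg matrix_vector_mult_scaleR matrix_vector_mult_diff_distrib matrix_vector_right_distrib)
  show ?thesis
    using caratheodory_diff[OF u caratheodory_bounded_linear[OF lin w]] by (simp only: eq)
qed

text \<open>\<open>q\<close> is the corrected variable minus the reduced trajectory. The fields are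
  compared at \<open>ue\<close> and \<open>u\<close>, which differ by \<open>q\<close> up to
  \<open>\<eta>\<close>, so Gronwall applies with inhomogeneity \<open>\<eta>\<close>. The summand 1
  in the constant pays for adding the correction \<open>\<epsilon> D w\<close> back.\<close>

lemma deviation_bound:
  assumes L: "\<And>c. c \<in> \<Omega>A \<times> \<Omega>B \<Longrightarrow> L-lipschitz_on (cball 0 R) (\<lambda>u. forcing c u - D *v equilibrium c u)"
    and \<epsilon>: "\<epsilon> > 0" and ctrl: "controls \<alpha> \<beta>" and sp: "sp \<epsilon> \<alpha> \<beta> ue ve we" and red: "red \<alpha> \<beta> u"
    and ue: "\<And>s. s \<in> {0..T} \<Longrightarrow> norm (ue s) \<le> R" and u: "\<And>s. s \<in> {0..T} \<Longrightarrow> norm (u s) \<le> R"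
    and \<eta>: "\<And>s. s \<in> {0..T} \<Longrightarrow> norm (\<epsilon> *\<^sub>R (D *v we s)) \<le> \<eta>"
    and t: "t \<in> {0..T}"
  shows "norm (ue t - u t) \<le> (2 * exp (3 * L * T) + 1) * \<eta>"
proof -
  define q where "q s = ue s - \<epsilon> *\<^sub>R (D *v we s) - u s" for s
  define r where "r s x = forcing (\<alpha> s, \<beta> s) x - D *v equilibrium (\<alpha> s, \<beta> s) x" for s x
  have 0: "0 \<in> {0..T}" using T by simp
  have \<eta>0: "0 \<le> \<eta>" using order_trans[OF norm_ge_zero \<eta>[OF 0]] .
  have L0: "0 \<le> L" using L[OF controls_measurable(2)[OF ctrl 0]] by (rule lipschitz_on_nonneg)
  have we0: "we 0 = w0" using sp by (simp add: sp_sol_def caratheodory_def)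
  have "caratheodory T (\<lambda>s. r s (ue s) - r s (u s)) (u0 - \<epsilon> *\<^sub>R (D *v w0) - u0) q"
    using caratheodory_diff[OF sp_corrected[OF \<epsilon> sp] red[unfolded red_iff]]
    by (simp add: r_def[abs_def] q_def[abs_def])
  moreover have "AE s in lebesgue_on {0..T}. norm (r s (ue s) - r s (u s)) \<le> L * (norm (q s) + \<eta>)"
  proof (rule AE_I2)
    fix s assume "s \<in> space (lebesgue_on {0..T})"
    then have s: "s \<in> {0..T}" by simp
    have "norm (r s (ue s) - r s (u s)) \<le> L * norm (ue s - u s)"
      unfolding r_def using lipschitz_on_normD[OF L[OF controls_measurable(2)[OF ctrl s]]] ue[OF s] u[OF s]
      by simp
    also have "norm (ue s - u s) \<le> norm (q s) + \<eta>"
      using norm_triangle_ineq[of "q s" "\<epsilon> *\<^sub>R (D *v we s)"] \<eta>[OF s] by (simp add: q_def)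
    finally show "norm (r s (ue s) - r s (u s)) \<le> L * (norm (q s) + \<eta>)"
      using L0 by (simp add: mult_left_mono)
  qed
  ultimately have "(norm (q t))\<^sup>2 + \<eta>\<^sup>2 \<le> exp (3 * L * T) * ((norm (u0 - \<epsilon> *\<^sub>R (D *v w0) - u0))\<^sup>2 + \<eta>\<^sup>2)"
    using t by (intro caratheodory_gronwall[OF _ L0 _ _ _ \<eta>0]) auto
  \<comment> \<open>The initial deviation is the correction at time 0 up to sign, so
    \<open>\<eta>\<close> bounds it as well.\<close>
  also have "\<dots> \<le> exp (3 * L * T) * (\<eta>\<^sup>2 + \<eta>\<^sup>2)"
    using \<eta>[OF 0] we0 by (intro mult_left_mono add_right_mono power_mono) auto
  also have "\<dots> = (2 * exp (3 * L * T)) * \<eta>\<^sup>2" by simp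
  \<comment> \<open>The constant is at least 1; squaring it makes the right-hand side a perfect
    square and keeps roots out of the final bound.\<close>
  also have "\<dots> \<le> (2 * exp (3 * L * T))\<^sup>2 * \<eta>\<^sup>2"
  proof (rule mult_right_mono)
    have "1 \<le> exp (3 * L * T)" using L0 T by simp
    then have "1 \<le> 2 * exp (3 * L * T)" by linarith
    then show "2 * exp (3 * L * T) \<le> (2 * exp (3 * L * T))\<^sup>2"
      by (rule self_le_power) simp
  qed simp
  finally have "(norm (q t))\<^sup>2 \<le> (2 * exp (3 * L * T) * \<eta>)\<^sup>2"
    using zero_le_power2[of \<eta>] by (simp only: power_mult_distrib)
  then have "norm (q t) \<le> 2 * exp (3 * L * T) * \<eta>"
    by (rule power2_le_imp_le) (use \<eta>0 in simp)
  moreover have "norm (ue t - u t) \<le> norm (q t) + \<eta>"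
    using norm_triangle_ineq[of "q t" "\<epsilon> *\<^sub>R (D *v we t)"] \<eta>[OF t] by (simp add: q_def)
  ultimately show ?thesis by (simp add: algebra_simps)
qed

text \<open>The radius, the Lipschitz constant on it and the rate are fixed in this order, all
  before the controls, so that \<open>\<mu>\<close> is common to every admissible pair.\<close>

lemma uniform_convergence:
  obtains \<mu> where "(\<mu> \<longlongrightarrow> 0) (at_right 0)" "\<And>\<epsilon>. \<epsilon> > 0 \<Longrightarrow> 0 \<le> \<mu> \<epsilon>"
    "\<And>\<alpha> \<beta> \<epsilon> ue ve we u s. \<lbrakk>\<epsilon> > 0; controls \<alpha> \<beta>; sp \<epsilon> \<alpha> \<beta> ue ve we; red \<alpha> \<beta> u; s \<in> {0..T}\<rbrakk>
      \<Longrightarrow> norm (ue s - u s) \<le> \<mu> \<epsilon>"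
proof -
  obtain R0 where R0: "0 \<le> R0"
    "\<And>\<alpha> \<beta> u t. \<lbrakk>controls \<alpha> \<beta>; red \<alpha> \<beta> u; t \<in> {0..T}\<rbrakk> \<Longrightarrow> norm (u t) \<le> R0"
    by (rule red_bounded) blast
  obtain K where K: "0 \<le> K" "\<And>\<epsilon> \<alpha> \<beta> u v w t. \<lbrakk>\<epsilon> > 0; controls \<alpha> \<beta>; sp \<epsilon> \<alpha> \<beta> u v w; t \<in> {0..T}\<rbrakk> \<Longrightarrow>
    (norm (u t))\<^sup>2 + \<epsilon> * (norm (w t))\<^sup>2
      \<le> exp (K * T) * ((norm u0)\<^sup>2 + (norm v0)\<^sup>2 + \<epsilon> * (norm w0)\<^sup>2 + 1)"
    by (rule sp_energy) blast
  define B where "B \<epsilon> = sqrt (exp (K * T) * ((norm u0)\<^sup>2 + (norm v0)\<^sup>2 + \<epsilon> * (norm w0)\<^sup>2 + 1))" for \<epsilon>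
  have B0: "0 \<le> B \<epsilon>" if "\<epsilon> > 0" for \<epsilon> using that by (simp add: B_def)
  have B_mono: "B \<epsilon> \<le> B 1" if "0 < \<epsilon>" "\<epsilon> \<le> 1" for \<epsilon>
    unfolding B_def using that mult_right_mono[of \<epsilon> 1 "(norm w0)\<^sup>2"]
    by (intro real_sqrt_le_mono mult_left_mono add_right_mono add_left_mono) auto
  have bound_u: "norm (u t) \<le> B \<epsilon>" and bound_w: "sqrt \<epsilon> * norm (w t) \<le> B \<epsilon>"
    if "\<epsilon> > 0" "controls \<alpha> \<beta>" "sp \<epsilon> \<alpha> \<beta> u v w" "t \<in> {0..T}" for \<epsilon> \<alpha> \<beta> u v w t
  proof -
    have le: "(norm (u t))\<^sup>2 + (sqrt \<epsilon> * norm (w t))\<^sup>2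
        \<le> exp (K * T) * ((norm u0)\<^sup>2 + (norm v0)\<^sup>2 + \<epsilon> * (norm w0)\<^sup>2 + 1)"
      using K(2)[OF that] that(1) by (simp add: power_mult_distrib)
    show "norm (u t) \<le> B \<epsilon>"
      unfolding B_def by (rule real_le_rsqrt) (use le zero_le_power2[of "sqrt \<epsilon> * norm (w t)"] in linarith)
    show "sqrt \<epsilon> * norm (w t) \<le> B \<epsilon>"
      unfolding B_def by (rule real_le_rsqrt) (use le zero_le_power2[of "norm (u t)"] in linarith)
  qed
  \<comment> \<open>Contains all reduced trajectories and, because \<open>B\<close> is monotone
    there, all perturbed ones with \<open>\<epsilon> \<le> 1\<close>.\<close>
  define R where "R = max R0 (B 1)"
  obtain L where L: "\<forall>c\<in>\<Omega>A \<times> \<Omega>B. L-lipschitz_on (cball 0 R) (\<lambda>u. forcing c u - D *v equilibrium c u)"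
    by (rule regular_field_lipschitz[OF regular_reduced])
  \<comment> \<open>The constant of \<open>deviation_bound\<close> for
    \<open>\<eta> = D_norm * B 1 * sqrt \<epsilon>\<close>: the energy bounds only
    \<open>sqrt \<epsilon> * norm w\<close>, which leaves one factor \<open>sqrt \<epsilon>\<close>
    in \<open>\<epsilon> * norm w\<close>.\<close>
  define M where "M = (2 * exp (3 * L * T) + 1) * (D_norm * B 1)"
  have M0: "0 \<le> M" unfolding M_def using B0[of 1] by (intro mult_nonneg_nonneg add_nonneg_nonneg) auto
  \<comment> \<open>The bound is demanded for every positive \<open>\<epsilon>\<close>. Above 1 the
    radius \<open>B \<epsilon>\<close> may exceed \<open>R\<close>, so the sum of the two a priori
    bounds is taken there, without effect on the limit.\<close>
  define \<mu> where "\<mu> \<epsilon> = (if \<epsilon> \<le> 1 then M * sqrt \<epsilon> else B \<epsilon> + R0)" for \<epsilon>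
  show ?thesis
  proof (rule that)
    have "((\<lambda>\<epsilon>. M * sqrt \<epsilon>) \<longlongrightarrow> M * sqrt 0) (at_right 0)"
      by (intro tendsto_intros)
    moreover have "\<forall>\<^sub>F \<epsilon> in at_right (0::real). M * sqrt \<epsilon> = \<mu> \<epsilon>"
    proof -
      have "\<forall>\<^sub>F \<epsilon> in at_right (0::real). \<epsilon> < 1"
        by (intro order_tendstoD(2)[OF tendsto_ident_at]) simp
      then show ?thesis by eventually_elim (simp add: \<mu>_def)
    qed
    ultimately show "(\<mu> \<longlongrightarrow> 0) (at_right 0)" using tendsto_cong by force
    show "0 \<le> \<mu> \<epsilon>" if "\<epsilon> > 0" for \<epsilon> using that M0 B0[OF that] R0(1) by (simp add: \<mu>_def)
    fix \<alpha> \<beta> \<epsilon> ue ve we u s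
    assume \<epsilon>: "\<epsilon> > 0" and ctrl: "controls \<alpha> \<beta>" and sp: "sp \<epsilon> \<alpha> \<beta> ue ve we" and red: "red \<alpha> \<beta> u"
      and s: "s \<in> {0..T}"
    show "norm (ue s - u s) \<le> \<mu> \<epsilon>"
    proof (cases "\<epsilon> \<le> 1")
      case True
      have "norm (ue s - u s) \<le> (2 * exp (3 * L * T) + 1) * (D_norm * B 1 * sqrt \<epsilon>)"
      proof (rule deviation_bound[OF bspec[OF L] \<epsilon> ctrl sp red _ _ _ s])
        fix t assume t: "t \<in> {0..T}"
        show "norm (ue t) \<le> R"
          using bound_u[OF \<epsilon> ctrl sp t] B_mono[OF \<epsilon> True] by (simp add: R_def)
        show "norm (u t) \<le> R"
          using R0(2)[OF ctrl red t] by (simp add: R_def)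
        have "norm (\<epsilon> *\<^sub>R (D *v we t)) = sqrt \<epsilon> * sqrt \<epsilon> * norm (D *v we t)" using \<epsilon> by simp
        also have "\<dots> \<le> sqrt \<epsilon> * sqrt \<epsilon> * (D_norm * norm (we t))"
          using \<epsilon> by (intro mult_left_mono norm_D) auto
        also have "\<dots> = D_norm * (sqrt \<epsilon> * norm (we t)) * sqrt \<epsilon>" by (simp only: mult_ac)
        also have "\<dots> \<le> D_norm * B 1 * sqrt \<epsilon>"
          using bound_w[OF \<epsilon> ctrl sp t] B_mono[OF \<epsilon> True] \<epsilon>
          by (intro mult_right_mono mult_left_mono) auto
        finally show "norm (\<epsilon> *\<^sub>R (D *v we t)) \<le> D_norm * B 1 * sqrt \<epsilon>" .
      qed
      then show ?thesis using True by (simp add: \<mu>_def M_def mult_ac)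
    next
      case False
      then show ?thesis
        using bound_u[OF \<epsilon> ctrl sp s] R0(2)[OF ctrl red s] norm_triangle_ineq4[of "ue s" "u s"]
        by (simp add: \<mu>_def)
    qed
  qed
qed

text \<open>The derivative of \<open>v - v'\<close> is bounded by \<open>a * D_norm * m\<close>
  alone. Weakening this to the Gronwall hypothesis with rate 1 and inhomogeneity
  \<open>\<eta>\<close> reuses the estimate already at hand, whence
  \<open>exp (3 * T)\<close>.\<close>

lemma deviation_bound_v:
  assumes v: "caratheodory T (\<lambda>s. - (a *\<^sub>R (D *v u s))) v0 v"
    and v': "caratheodory T (\<lambda>s. - (a *\<^sub>R (D *v u' s))) v0 v'"
    and m: "\<And>s. s \<in> {0..T} \<Longrightarrow> norm (u s - u' s) \<le> m" and t: "t \<in> {0..T}"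
  shows "norm (v t - v' t) \<le> exp (3 * T) * (a * D_norm * m)"
proof -
  define \<eta> where "\<eta> = a * D_norm * m"
  have "0 \<le> m" using order_trans[OF norm_ge_zero m[of 0]] T by simp
  then have \<eta>: "0 \<le> \<eta>" using a by (simp add: \<eta>_def)
  have "AE s in lebesgue_on {0..T}. norm (- (a *\<^sub>R (D *v u s)) - - (a *\<^sub>R (D *v u' s)))
      \<le> 1 * (norm (v s - v' s) + \<eta>)"
  proof (rule AE_I2)
    fix s assume s: "s \<in> space (lebesgue_on {0..T})"
    have "- (a *\<^sub>R (D *v u s)) - - (a *\<^sub>R (D *v u' s)) = - (a *\<^sub>R (D *v (u s - u' s)))"
      by (simp add: matrix_vector_mult_diff_distrib scaleR_diff_right)
    also have "norm \<dots> \<le> a * (D_norm * norm (u s - u' s))"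
      using a norm_D[of "u s - u' s"] by simp
    also have "\<dots> \<le> \<eta>"
      unfolding \<eta>_def mult.assoc using a m[of s] s by (intro mult_left_mono) auto
    finally show "norm (- (a *\<^sub>R (D *v u s)) - - (a *\<^sub>R (D *v u' s))) \<le> 1 * (norm (v s - v' s) + \<eta>)"
      by (simp add: add_increasing)
  qed
  from caratheodory_gronwall[OF caratheodory_diff[OF v v'] _ _ _ this \<eta>, of t] t
  have "(norm (v t - v' t))\<^sup>2 + \<eta>\<^sup>2 \<le> exp (3 * T) * \<eta>\<^sup>2" by simp
  also have "\<dots> \<le> (exp (3 * T))\<^sup>2 * \<eta>\<^sup>2"
    using T by (intro mult_right_mono self_le_power) auto
  finally have "(norm (v t - v' t))\<^sup>2 \<le> (exp (3 * T) * \<eta>)\<^sup>2"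
    using zero_le_power2[of \<eta>] by (simp only: power_mult_distrib)
  then show ?thesis
    unfolding \<eta>_def[symmetric] by (rule power2_le_imp_le) (use \<eta> in simp)
qed

section \<open>Optimal values and approximating controls\<close>

abbreviation sp_costs :: "(real^'m \<Rightarrow> real) \<Rightarrow> real \<Rightarrow> real set" where
  "sp_costs \<Phi> \<epsilon> \<equiv> {\<Phi> (u T) | u v w \<alpha> \<beta>. admissible T \<Omega>A \<alpha> \<and> admissible T \<Omega>B \<beta> \<and> sp \<epsilon> \<alpha> \<beta> u v w}"

abbreviation red_costs :: "(real^'m \<Rightarrow> real) \<Rightarrow> real set" where
  "red_costs \<Phi> \<equiv> {\<Phi> (u T) | u \<alpha> \<beta>. admissible T \<Omega>A \<alpha> \<and> admissible T \<Omega>B \<beta> \<and> red \<alpha> \<beta> u}"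

lemma red_costs_bdd_below:
  assumes \<Phi>: "continuous_on UNIV \<Phi>"
  shows "bdd_below (red_costs \<Phi>)"
proof -
  obtain R where R: "0 \<le> R"
    "\<And>\<alpha> \<beta> u t. \<lbrakk>controls \<alpha> \<beta>; red \<alpha> \<beta> u; t \<in> {0..T}\<rbrakk> \<Longrightarrow> norm (u t) \<le> R"
    by (rule red_bounded) blast
  have "compact (\<Phi> ` cball 0 R)"
    by (rule compact_continuous_image[OF continuous_on_subset[OF \<Phi>]]) auto
  then have "bdd_below (\<Phi> ` cball 0 R)" by (intro bounded_imp_bdd_below compact_imp_bounded)
  then show ?thesis
  proof (rule bdd_below_mono, clarify)
    fix u \<alpha> \<beta> assume "admissible T \<Omega>A \<alpha>" "admissible T \<Omega>B \<beta>" "red \<alpha> \<beta> u"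
    then have "norm (u T) \<le> R" using T by (intro R(2)[of \<alpha> \<beta>]) auto
    then show "\<Phi> (u T) \<in> \<Phi> ` cball 0 R" by simp
  qed
qed

lemma value_deviation:
  assumes \<Phi>: "continuous_on UNIV \<Phi>"
    and k: "\<And>\<alpha> \<beta> ue ve we u. \<lbrakk>controls \<alpha> \<beta>; sp \<epsilon> \<alpha> \<beta> ue ve we; red \<alpha> \<beta> u\<rbrakk> \<Longrightarrow> \<bar>\<Phi> (ue T) - \<Phi> (u T)\<bar> \<le> k"
    and k0: "0 \<le> k"
  shows "\<bar>sp_value T a D F H G u0 v0 w0 \<Omega>A \<Omega>B \<Phi> \<epsilon> - red_value T D F H G u0 \<Omega>A \<Omega>B \<Phi>\<bar> \<le> k"
proof (cases "\<exists>\<alpha> \<beta>. controls \<alpha> \<beta>")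
  case False
  \<comment> \<open>Without admissible controls both values are the infimum of the empty set, the
    same real number.\<close>
  then have "sp_costs \<Phi> \<epsilon> = red_costs \<Phi>" by auto
  then show ?thesis using k0 by (simp add: sp_value_def red_value_def)
next
  case True
  have sp_red: "\<exists>y\<in>red_costs \<Phi>. \<bar>x - y\<bar> \<le> k" if x: "x \<in> sp_costs \<Phi> \<epsilon>" for x
  proof -
    obtain u v w \<alpha> \<beta> where *: "x = \<Phi> (u T)" "controls \<alpha> \<beta>" "sp \<epsilon> \<alpha> \<beta> u v w" using x by blast
    obtain u' where "red \<alpha> \<beta> u'" using red_exists[OF *(2)] by blast
    with * k show ?thesis by (intro bexI[of _ "\<Phi> (u' T)"]) blast+
  qed
  have red_sp: "\<exists>x\<in>sp_costs \<Phi> \<epsilon>. \<bar>x - y\<bar> \<le> k" if y: "y \<in> red_costs \<Phi>" for y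
  proof -
    obtain u \<alpha> \<beta> where *: "y = \<Phi> (u T)" "controls \<alpha> \<beta>" "red \<alpha> \<beta> u" using y by blast
    obtain u' v w where "sp \<epsilon> \<alpha> \<beta> u' v w" using sp_exists[OF *(2)] by blast
    with * k show ?thesis by (intro bexI[of _ "\<Phi> (u' T)"]) blast+
  qed
  have ne: "red_costs \<Phi> \<noteq> {}" using True red_exists by blast
  then have ne': "sp_costs \<Phi> \<epsilon> \<noteq> {}" using red_sp by blast
  obtain m where m: "\<And>y. y \<in> red_costs \<Phi> \<Longrightarrow> m \<le> y"
    using red_costs_bdd_below[OF \<Phi>] unfolding bdd_below_def by blast
  \<comment> \<open>The lower bound is borrowed from the reduced costs through the pairing, at the
    price of \<open>k\<close>.\<close>
  have "bdd_below (sp_costs \<Phi> \<epsilon>)"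
  proof (rule bdd_belowI)
    fix x assume "x \<in> sp_costs \<Phi> \<epsilon>"
    then obtain y where "y \<in> red_costs \<Phi>" "\<bar>x - y\<bar> \<le> k" using sp_red by blast
    then show "m - k \<le> x" using m[of y] by linarith
  qed
  then show ?thesis
    unfolding sp_value_def red_value_def
    by (intro cInf_abs_diff_le ne ne' red_costs_bdd_below[OF \<Phi>] sp_red red_sp)
qed

lemma approximation:
  assumes \<Phi>: "continuous_on UNIV \<Phi>"
  shows "approximated_by_reduced T a D F H G u0 v0 w0 \<Omega>A \<Omega>B \<Phi>"
    and "converges_to_reduced T a D F H G u0 v0 w0 \<Omega>A \<Omega>B"
    and "(sp_value T a D F H G u0 v0 w0 \<Omega>A \<Omega>B \<Phi> \<longlongrightarrow> red_value T D F H G u0 \<Omega>A \<Omega>B \<Phi>) (at_right 0)"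
proof -
  let ?V = "sp_value T a D F H G u0 v0 w0 \<Omega>A \<Omega>B \<Phi>"
  let ?W = "red_value T D F H G u0 \<Omega>A \<Omega>B \<Phi>"
  obtain \<mu> where \<mu>: "(\<mu> \<longlongrightarrow> 0) (at_right 0)" "\<And>\<epsilon>. \<epsilon> > 0 \<Longrightarrow> 0 \<le> \<mu> \<epsilon>"
    and dev: "\<And>\<alpha> \<beta> \<epsilon> ue ve we u s. \<lbrakk>\<epsilon> > 0; controls \<alpha> \<beta>; sp \<epsilon> \<alpha> \<beta> ue ve we; red \<alpha> \<beta> u; s \<in> {0..T}\<rbrakk>
      \<Longrightarrow> norm (ue s - u s) \<le> \<mu> \<epsilon>"
    by (rule uniform_convergence) blast
  show "converges_to_reduced T a D F H G u0 v0 w0 \<Omega>A \<Omega>B"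
    unfolding converges_to_reduced_def using \<mu>(1) dev by blast
  obtain R where R: "0 \<le> R"
    "\<And>\<alpha> \<beta> u t. \<lbrakk>controls \<alpha> \<beta>; red \<alpha> \<beta> u; t \<in> {0..T}\<rbrakk> \<Longrightarrow> norm (u t) \<le> R"
    by (rule red_bounded) blast
  obtain \<kappa> where \<kappa>: "(\<kappa> \<longlongrightarrow> 0) (at_right 0)"
    "\<forall>\<epsilon>>0. \<forall>x y. norm y \<le> R \<longrightarrow> norm (x - y) \<le> \<mu> \<epsilon> \<longrightarrow> \<bar>\<Phi> x - \<Phi> y\<bar> \<le> \<kappa> \<epsilon>"
    by (rule uniform_modulus[OF \<Phi> \<mu> R(1)])
  have TT: "T \<in> {0..T}" using T by simp
  have cost: "\<bar>\<Phi> (ue T) - \<Phi> (u T)\<bar> \<le> \<kappa> \<epsilon>"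
    if "\<epsilon> > 0" "controls \<alpha> \<beta>" "sp \<epsilon> \<alpha> \<beta> ue ve we" "red \<alpha> \<beta> u" for \<epsilon> \<alpha> \<beta> ue ve we u
    by (rule \<kappa>(2)[rule_format, OF that(1) R(2)[OF that(2,4) TT] dev[OF that TT]])
  have \<kappa>0: "0 \<le> \<kappa> \<epsilon>" if "\<epsilon> > 0" for \<epsilon> using \<kappa>(2)[rule_format, OF that, of 0 0] R(1) \<mu>(2)[OF that] by simp
  have V: "\<bar>?V \<epsilon> - ?W\<bar> \<le> \<kappa> \<epsilon>" if "\<epsilon> > 0" for \<epsilon>
    by (rule value_deviation[OF \<Phi> _ \<kappa>0[OF that]]) (rule cost[OF that])
  show V_lim: "(?V \<longlongrightarrow> ?W) (at_right 0)"
  proof (rule LIM_zero_cancel, rule Lim_null_comparison[OF _ \<kappa>(1)])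
    show "\<forall>\<^sub>F \<epsilon> in at_right 0. norm (?V \<epsilon> - ?W) \<le> \<kappa> \<epsilon>"
      using eventually_at_right_less[of "0::real"] by eventually_elim (simp add: V)
  qed
  have approx: "\<exists>\<alpha> \<beta>. approximating_control T a D F H G u0 v0 w0 \<Omega>A \<Omega>B ub vb \<alpha> \<beta> \<and>
           (\<exists>\<kappa>. (\<kappa> \<longlongrightarrow> 0) (at_right 0) \<and>
              (\<forall>\<epsilon>>0. \<forall>u v w. sp \<epsilon> \<alpha> \<beta> u v w \<longrightarrow> \<bar>\<Phi> (u T) - ?V \<epsilon>\<bar> \<le> \<nu> + \<kappa> \<epsilon>))"
    if traj: "red_traj T a D F H G u0 v0 \<Omega>A \<Omega>B ub vb" and opt: "\<Phi> (ub T) \<le> ?W + \<nu>" for \<nu> ub vb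
  proof -
    obtain \<alpha> \<beta> where ctrl: "controls \<alpha> \<beta>" and ub: "red \<alpha> \<beta> ub"
      and vb: "caratheodory T (\<lambda>s. - (a *\<^sub>R (D *v ub s))) v0 vb"
      using traj by (auto simp: red_traj_def)
    have "approximating_control T a D F H G u0 v0 w0 \<Omega>A \<Omega>B ub vb \<alpha> \<beta>"
      unfolding approximating_control_def
    \<comment> \<open>The first summand bounds the deviation of \<open>u\<close>, the second that of
      \<open>v\<close>, which the former drives.\<close>
    proof (intro conjI exI[of _ "\<lambda>\<epsilon>. \<mu> \<epsilon> + exp (3 * T) * (a * D_norm * \<mu> \<epsilon>)"] allI impI)
      show "admissible T \<Omega>A \<alpha>" "admissible T \<Omega>B \<beta>" using ctrl by auto
      show "((\<lambda>\<epsilon>. \<mu> \<epsilon> + exp (3 * T) * (a * D_norm * \<mu> \<epsilon>)) \<longlongrightarrow> 0) (at_right 0)"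
        using \<mu>(1) by (auto intro!: tendsto_eq_intros)
      fix \<epsilon> :: real assume \<epsilon>: "\<epsilon> > 0"
      obtain u v w where s: "sp \<epsilon> \<alpha> \<beta> u v w" using sp_exists[OF ctrl] by blast
      have du: "norm (u t - ub t) \<le> \<mu> \<epsilon>" if "t \<in> {0..T}" for t
        by (rule dev[OF \<epsilon> ctrl s ub that])
      have v: "caratheodory T (\<lambda>s. - (a *\<^sub>R (D *v u s))) v0 v" using s by (simp add: sp_sol_def)
      have "norm ((u t, v t) - (ub t, vb t)) \<le> \<mu> \<epsilon> + exp (3 * T) * (a * D_norm * \<mu> \<epsilon>)" if t: "t \<in> {0..T}" for t
        using norm_Pair_le[of "u t - ub t" "v t - vb t"] du[OF t] deviation_bound_v[OF v vb du t] by simp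
      with s show "\<exists>u v w. sp \<epsilon> \<alpha> \<beta> u v w \<and>
          (\<forall>s\<in>{0..T}. norm ((u s, v s) - (ub s, vb s)) \<le> \<mu> \<epsilon> + exp (3 * T) * (a * D_norm * \<mu> \<epsilon>))"
        by blast
    qed
    \<comment> \<open>The difference passes through \<open>\<Phi> (ub T)\<close> and the reduced
      value. One \<open>\<kappa> \<epsilon>\<close> is the cost deviation under equal controls, the
      other the deviation of the values; \<open>\<nu>\<close> is the gap by which \<open>ub\<close>
      may fail to be optimal.\<close>
    moreover have "\<bar>\<Phi> (u T) - ?V \<epsilon>\<bar> \<le> \<nu> + 2 * \<kappa> \<epsilon>" if \<epsilon>: "\<epsilon> > 0" and s: "sp \<epsilon> \<alpha> \<beta> u v w" for \<epsilon> u v w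
    proof -
      have "\<Phi> (ub T) \<in> red_costs \<Phi>" using ctrl ub by blast
      then have "?W \<le> \<Phi> (ub T)"
        unfolding red_value_def by (rule cInf_lower[OF _ red_costs_bdd_below[OF \<Phi>]])
      then show ?thesis using cost[OF \<epsilon> ctrl s ub] V[OF \<epsilon>] opt by linarith
    qed
    moreover have "((\<lambda>\<epsilon>. 2 * \<kappa> \<epsilon>) \<longlongrightarrow> 0) (at_right 0)"
      using \<kappa>(1) by (auto intro!: tendsto_eq_intros)
    ultimately show ?thesis by blast
  qed
  show "approximated_by_reduced T a D F H G u0 v0 w0 \<Omega>A \<Omega>B \<Phi>"
    unfolding approximated_by_reduced_def
    by (intro conjI V_lim allI impI, elim conjE) (rule approx)
qed

end

theorem corollary5p1:
  fixes T a :: real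
    and D :: "real^'m^'m"
    and F :: "real^'m \<Rightarrow> real^'m"
    and H :: "real^'m \<Rightarrow> real^'p^'m"
    and G :: "real^'m \<Rightarrow> real^'q^'m"
    and u0 v0 w0 :: "real^'m"
    and \<Omega>A :: "(real^'p) set"
    and \<Omega>B :: "(real^'q) set"
    and \<Phi> :: "real^'m \<Rightarrow> real"
  assumes "T > 0" and "a > 0"
    and "compact \<Omega>A" and "convex \<Omega>A"
    and "compact \<Omega>B" and "convex \<Omega>B"
    and "loc_lipschitz F" and "linear_growth F"
    and "loc_lipschitz H" and "linear_growth H"
    and "loc_lipschitz G" and "linear_growth G"
    and "continuous_on UNIV \<Phi>"
  shows "approximated_by_reduced T a D F H G u0 v0 w0 \<Omega>A \<Omega>B \<Phi> \<and>
         converges_to_reduced T a D F H G u0 v0 w0 \<Omega>A \<Omega>B \<and>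
         (sp_value T a D F H G u0 v0 w0 \<Omega>A \<Omega>B \<Phi> \<longlongrightarrow> red_value T D F H G u0 \<Omega>A \<Omega>B \<Phi>) (at_right 0)"
proof -
  interpret slow_fast_control T a D F H G u0 v0 w0 \<Omega>A \<Omega>B
    by (rule slow_fast_control.intro) (fact assms)+
  show ?thesis
    by (intro conjI approximation[OF assms(13)])
qed

end
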